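(* Let $(X,G,\Phi)$ be a dynamical system, where $X$ is a compact totally disconnected Hausdorff space, and let $S$ be a finite subset of $G$. (i) If $\Phi$ has the $S$-shadowing property, then $(X,G,\Phi)$ is conjugate to the inverse limit of an ML inverse system of shifts of finite type over $S\cup\{e_G\}$. (ii) If $(X,G,\Phi)$ is conjugate to the inverse limit of an ML inverse system of subshifts (over $G$) which have the $S$-shadowing property, then $\Phi$ has the $S$-shadowing property.
   Context: $G$ is a countable discrete group with identity $e_G$. A dynamical system $(X,G,\Phi)$ consists of a compact Hausdorff space $X$ and $\Phi:G\times X\to X$ such that each $\Phi_g:=\Phi(g,\cdot)$ is a homeomorphism, $\Phi_{e_G}=\mathrm{id}_X$ and $\Phi_{gg'}=\Phi_g\circ\Phi_{g'}$. Shadowing. A finite open cover of $X$ never contains the empty set. Let $S\subset G$ and let $\mathcal U$ be a finite open cover of $X$. A family $\{x_g\}_{g\in G}$ in $X$ is an $(S,\mathcal U)$-pseudo-orbit if there is a family $\{U_g\}_{g\in G}$ in $\mathcal U$ such that $x_{sg},\Phi_s(x_g)\in U_{sg}$ for all $g\in G$, $s\in S$. A point $z\in X$ $\mathcal U$-shadows $\{x_g\}_{g\in G}$ if for each $g\in G$ there is $U_g\in\mathcal U$ with $\Phi_g(z),x_g\in U_g$. $\Phi$ has the $S$-shadowing property if for every finite open cover $\mathcal U$ of $X$ there is a finite open cover $\mathcal V$ of $X$ such that every $(S,\mathcal V)$-pseudo-orbit is $\mathcal U$-shadowed by some point of $X$. Subshifts. For a finite set $\Sigma$, $G$ acts on $\Sigma^G$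 (product topology, $\Sigma$ discrete) by $\sigma_g(x)(h)=x(hg)$. A subshift is a closed $G$-invariant subset of some $\Sigma^G$, regarded as a dynamical system under $\sigma$. For $A\subset G$ and $P\in\Sigma^A$ let $C(P)=\{y\in\Sigma^G: y(g)=P(g)\ \forall g\in A\}$. For finite $A\subset G$, a subshift $X\subset\Sigma^G$ is a shift of finite type over $A$ if there is $\mathcal F\subset\Sigma^A$ with $X=\{x\in\Sigma^G:\sigma_g(x)\notin C(P)\text{ for all }g\in G,\ P\in\mathcal F\}$. Inverse limits. For a directed set $(\Lambda,\le)$, an inverse system $(\phi^\eta_\lambda,(X_\lambda,G,\Phi^\lambda))$ of dynamical systems consists of dynamical systems $(X_\lambda,G,\Phi^\lambda)$, $\lambda\in\Lambda$, and continuous (not necessarily surjective) maps $\phi^\eta_\lambda:X_\eta\to X_\lambda$ for $\lambda\le\eta$ with $\phi^\lambda_\lambda=\mathrm{id}$, $\phi^\gamma_\lambda=\phi^\eta_\lambda\circ\phi^\gamma_\eta$ for $\lambda\le\eta\le\gamma$, and $\Phi^\lambda_g\circ\phi^\eta_\lambda=\phi^\eta_\lambda\circ\Phi^\eta_g$ for all $g\in G$. Its inverse limit is the space of all $(x_\lambda)\in\prod_\lambda X_\lambda$ with $x_\lambda=\phi^\eta_\lambda(x_\eta)$ for all $\lambda\le\eta$, with the subspace topology and the coordinatewise $G$-action. It is an ML inverse system (satisfies the Mittag-Leffler condition) if for every $\lambda$ there is $\eta\ge\lambda$ such that $\phi^\gamma_\lambda(X_\gamma)=\phi^\eta_\lambda(X_\eta)$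 for all $\gamma\ge\eta$. Two systems are conjugate if there is a $G$-equivariant homeomorphism between them. *)

theory Defs
  imports "HOL-Analysis.Analysis" "HOL-Algebra.Group"
begin

text \<open>A phase space is a topology \<open>X\<close> with underlying set \<^term>\<open>topspace X\<close>; an action is a curried
  function \<open>\<Phi> g x\<close> of which only the values at \<open>g \<in> carrier G\<close>, \<open>x \<in> topspace X\<close> are relevant.\<close>

definition totally_disconnected_space :: "'x topology \<Rightarrow> bool" where
  "totally_disconnected_space X \<longleftrightarrow> (\<forall>C. connectedin X C \<longrightarrow> (\<exists>a. C \<subseteq> {a}))"

definition dynamical_system ::
    "('g, 'm) monoid_scheme \<Rightarrow> 'x topology \<Rightarrow> ('g \<Rightarrow> 'x \<Rightarrow> 'x) \<Rightarrow> bool" where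
  "dynamical_system G X \<Phi> \<longleftrightarrow>
     compact_space X \<and> Hausdorff_space X \<and>
     (\<forall>g\<in>carrier G. homeomorphic_map X X (\<Phi> g)) \<and>
     (\<forall>x\<in>topspace X. \<Phi> \<one>\<^bsub>G\<^esub> x = x) \<and>
     (\<forall>g\<in>carrier G. \<forall>h\<in>carrier G. \<forall>x\<in>topspace X. \<Phi> (g \<otimes>\<^bsub>G\<^esub> h) x = \<Phi> g (\<Phi> h x))"

definition conjugate ::
    "('g, 'm) monoid_scheme \<Rightarrow> 'x topology \<Rightarrow> ('g \<Rightarrow> 'x \<Rightarrow> 'x)
      \<Rightarrow> 'y topology \<Rightarrow> ('g \<Rightarrow> 'y \<Rightarrow> 'y) \<Rightarrow> bool" where
  "conjugate G X \<Phi> Y \<Psi> \<longleftrightarrow>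
     (\<exists>h. homeomorphic_map X Y h \<and>
          (\<forall>g\<in>carrier G. \<forall>x\<in>topspace X. h (\<Phi> g x) = \<Psi> g (h x)))"


section \<open>Shadowing\<close>

definition finite_open_cover :: "'x topology \<Rightarrow> 'x set set \<Rightarrow> bool" where
  "finite_open_cover X \<U> \<longleftrightarrow>
     finite \<U> \<and> (\<forall>U\<in>\<U>. openin X U \<and> U \<noteq> {}) \<and> \<Union>\<U> = topspace X"

definition pseudo_orbit ::
    "('g, 'm) monoid_scheme \<Rightarrow> 'x topology \<Rightarrow> ('g \<Rightarrow> 'x \<Rightarrow> 'x)
      \<Rightarrow> 'g set \<Rightarrow> 'x set set \<Rightarrow> ('g \<Rightarrow> 'x) \<Rightarrow> bool" where
  "pseudo_orbit G X \<Phi> S \<U> x \<longleftrightarrow>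
     (\<forall>g\<in>carrier G. x g \<in> topspace X) \<and>
     (\<exists>U. (\<forall>g\<in>carrier G. U g \<in> \<U>) \<and>
          (\<forall>g\<in>carrier G. \<forall>s\<in>S.
             x (s \<otimes>\<^bsub>G\<^esub> g) \<in> U (s \<otimes>\<^bsub>G\<^esub> g) \<and> \<Phi> s (x g) \<in> U (s \<otimes>\<^bsub>G\<^esub> g)))"

definition shadows ::
    "('g, 'm) monoid_scheme \<Rightarrow> ('g \<Rightarrow> 'x \<Rightarrow> 'x) \<Rightarrow> 'x set set \<Rightarrow> 'x \<Rightarrow> ('g \<Rightarrow> 'x) \<Rightarrow> bool" where
  "shadows G \<Phi> \<U> z x \<longleftrightarrow> (\<forall>g\<in>carrier G. \<exists>U\<in>\<U>. \<Phi> g z \<in> U \<and> x g \<in> U)"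

definition shadowing_property ::
    "('g, 'm) monoid_scheme \<Rightarrow> 'x topology \<Rightarrow> ('g \<Rightarrow> 'x \<Rightarrow> 'x) \<Rightarrow> 'g set \<Rightarrow> bool" where
  "shadowing_property G X \<Phi> S \<longleftrightarrow>
     (\<forall>\<U>. finite_open_cover X \<U> \<longrightarrow>
        (\<exists>\<V>. finite_open_cover X \<V> \<and>
           (\<forall>x. pseudo_orbit G X \<Phi> S \<V> x \<longrightarrow> (\<exists>z\<in>topspace X. shadows G \<Phi> \<U> z x))))"


section \<open>Subshifts\<close>

text \<open>The set \<open>\<Sigma>\<^sup>A\<close> is \<open>A \<rightarrow>\<^sub>E \<Sigma>\<close>, the functions \<open>A \<rightarrow> \<Sigma>\<close> made equal to \<^term>\<open>undefined\<close> off \<open>A\<close>.\<close>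

definition full_shift :: "('g, 'm) monoid_scheme \<Rightarrow> 'a set \<Rightarrow> ('g \<Rightarrow> 'a) topology" where
  "full_shift G \<Sigma> = product_topology (\<lambda>_. discrete_topology \<Sigma>) (carrier G)"

definition shift :: "('g, 'm) monoid_scheme \<Rightarrow> 'g \<Rightarrow> ('g \<Rightarrow> 'a) \<Rightarrow> ('g \<Rightarrow> 'a)" where
  "shift G g x = (\<lambda>h\<in>carrier G. x (h \<otimes>\<^bsub>G\<^esub> g))"

definition subshift :: "('g, 'm) monoid_scheme \<Rightarrow> 'a set \<Rightarrow> ('g \<Rightarrow> 'a) set \<Rightarrow> bool" where
  "subshift G \<Sigma> Y \<longleftrightarrow>
     finite \<Sigma> \<and> closedin (full_shift G \<Sigma>) Y \<and> (\<forall>g\<in>carrier G. \<forall>y\<in>Y. shift G g y \<in> Y)"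

abbreviation subshift_space ::
    "('g, 'm) monoid_scheme \<Rightarrow> 'a set \<Rightarrow> ('g \<Rightarrow> 'a) set \<Rightarrow> ('g \<Rightarrow> 'a) topology" where
  "subshift_space G \<Sigma> Y \<equiv> subtopology (full_shift G \<Sigma>) Y"

definition cylinder ::
    "('g, 'm) monoid_scheme \<Rightarrow> 'a set \<Rightarrow> 'g set \<Rightarrow> ('g \<Rightarrow> 'a) \<Rightarrow> ('g \<Rightarrow> 'a) set" where
  "cylinder G \<Sigma> A P = {y \<in> carrier G \<rightarrow>\<^sub>E \<Sigma>. \<forall>g\<in>A. y g = P g}"

definition shift_of_finite_type ::
    "('g, 'm) monoid_scheme \<Rightarrow> 'a set \<Rightarrow> 'g set \<Rightarrow> ('g \<Rightarrow> 'a) set \<Rightarrow> bool" where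
  "shift_of_finite_type G \<Sigma> A Y \<longleftrightarrow>
     subshift G \<Sigma> Y \<and> finite A \<and> A \<subseteq> carrier G \<and>
     (\<exists>\<F> \<subseteq> A \<rightarrow>\<^sub>E \<Sigma>.
        Y = {x \<in> carrier G \<rightarrow>\<^sub>E \<Sigma>. \<forall>g\<in>carrier G. \<forall>P\<in>\<F>. shift G g x \<notin> cylinder G \<Sigma> A P})"


section \<open>Inverse limits\<close>

text \<open>The order of the index set \<open>\<Lambda>\<close> is a relation \<open>R\<close>, where \<open>(i, j) \<in> R\<close> stands for \<open>i \<le> j\<close>.
  The bonding map \<open>\<phi> i j\<close> goes from \<open>X j\<close> to \<open>X i\<close>.\<close>

definition directed_set :: "'l set \<Rightarrow> 'l rel \<Rightarrow> bool" where
  "directed_set \<Lambda> R \<longleftrightarrow>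
     \<Lambda> \<noteq> {} \<and> preorder_on \<Lambda> R \<and> (\<forall>i\<in>\<Lambda>. \<forall>j\<in>\<Lambda>. \<exists>k\<in>\<Lambda>. (i, k) \<in> R \<and> (j, k) \<in> R)"

definition inverse_system ::
    "('g, 'm) monoid_scheme \<Rightarrow> 'l set \<Rightarrow> 'l rel \<Rightarrow> ('l \<Rightarrow> 'y topology)
      \<Rightarrow> ('l \<Rightarrow> 'g \<Rightarrow> 'y \<Rightarrow> 'y) \<Rightarrow> ('l \<Rightarrow> 'l \<Rightarrow> 'y \<Rightarrow> 'y) \<Rightarrow> bool" where
  "inverse_system G \<Lambda> R X \<Phi> \<phi> \<longleftrightarrow>
     directed_set \<Lambda> R \<and>
     (\<forall>i\<in>\<Lambda>. dynamical_system G (X i) (\<Phi> i)) \<and>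
     (\<forall>i j. (i, j) \<in> R \<longrightarrow> continuous_map (X j) (X i) (\<phi> i j)) \<and>
     (\<forall>i\<in>\<Lambda>. \<forall>x\<in>topspace (X i). \<phi> i i x = x) \<and>
     (\<forall>i j k. (i, j) \<in> R \<longrightarrow> (j, k) \<in> R \<longrightarrow>
        (\<forall>x\<in>topspace (X k). \<phi> i k x = \<phi> i j (\<phi> j k x))) \<and>
     (\<forall>i j. (i, j) \<in> R \<longrightarrow>
        (\<forall>g\<in>carrier G. \<forall>x\<in>topspace (X j). \<Phi> i g (\<phi> i j x) = \<phi> i j (\<Phi> j g x)))"

definition mittag_leffler ::
    "'l set \<Rightarrow> 'l rel \<Rightarrow> ('l \<Rightarrow> 'y topology) \<Rightarrow> ('l \<Rightarrow> 'l \<Rightarrow> 'y \<Rightarrow> 'y) \<Rightarrow> bool" where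
  "mittag_leffler \<Lambda> R X \<phi> \<longleftrightarrow>
     (\<forall>i\<in>\<Lambda>. \<exists>j. (i, j) \<in> R \<and>
        (\<forall>k. (j, k) \<in> R \<longrightarrow> \<phi> i k ` topspace (X k) = \<phi> i j ` topspace (X j)))"

definition inverse_limit ::
    "'l set \<Rightarrow> 'l rel \<Rightarrow> ('l \<Rightarrow> 'y topology) \<Rightarrow> ('l \<Rightarrow> 'l \<Rightarrow> 'y \<Rightarrow> 'y) \<Rightarrow> ('l \<Rightarrow> 'y) topology" where
  "inverse_limit \<Lambda> R X \<phi> =
     subtopology (product_topology X \<Lambda>) {x. \<forall>i j. (i, j) \<in> R \<longrightarrow> x i = \<phi> i j (x j)}"

definition inverse_limit_action ::
    "'l set \<Rightarrow> ('l \<Rightarrow> 'g \<Rightarrow> 'y \<Rightarrow> 'y) \<Rightarrow> 'g \<Rightarrow> ('l \<Rightarrow> 'y) \<Rightarrow> ('l \<Rightarrow> 'y)" where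
  "inverse_limit_action \<Lambda> \<Phi> g x = (\<lambda>i\<in>\<Lambda>. \<Phi> i g (x i))"

text \<open>The next predicate concerns an inverse system of subshifts \<open>Y i\<close> over \<open>G\<close>, the alphabets
  \<open>\<Sigma> i\<close> being subsets of one ambient type.\<close>

definition subshift_ml_system ::
    "('g, 'm) monoid_scheme \<Rightarrow> 'l set \<Rightarrow> 'l rel \<Rightarrow> ('l \<Rightarrow> 'a set) \<Rightarrow> ('l \<Rightarrow> ('g \<Rightarrow> 'a) set)
      \<Rightarrow> ('l \<Rightarrow> 'l \<Rightarrow> ('g \<Rightarrow> 'a) \<Rightarrow> ('g \<Rightarrow> 'a)) \<Rightarrow> bool" where
  "subshift_ml_system G \<Lambda> R \<Sigma> Y \<phi> \<longleftrightarrow>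
     (\<forall>i\<in>\<Lambda>. subshift G (\<Sigma> i) (Y i)) \<and>
     inverse_system G \<Lambda> R (\<lambda>i. subshift_space G (\<Sigma> i) (Y i)) (\<lambda>_. shift G) \<phi> \<and>
     mittag_leffler \<Lambda> R (\<lambda>i. subshift_space G (\<Sigma> i) (Y i)) \<phi>"

definition conjugate_to_subshift_limit ::
    "('g, 'm) monoid_scheme \<Rightarrow> 'x topology \<Rightarrow> ('g \<Rightarrow> 'x \<Rightarrow> 'x) \<Rightarrow> 'l set \<Rightarrow> 'l rel
      \<Rightarrow> ('l \<Rightarrow> 'a set) \<Rightarrow> ('l \<Rightarrow> ('g \<Rightarrow> 'a) set)
      \<Rightarrow> ('l \<Rightarrow> 'l \<Rightarrow> ('g \<Rightarrow> 'a) \<Rightarrow> ('g \<Rightarrow> 'a)) \<Rightarrow> bool" where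
  "conjugate_to_subshift_limit G X \<Phi> \<Lambda> R \<Sigma> Y \<phi> \<longleftrightarrow>
     conjugate G X \<Phi>
       (inverse_limit \<Lambda> R (\<lambda>i. subshift_space G (\<Sigma> i) (Y i)) \<phi>)
       (inverse_limit_action \<Lambda> (\<lambda>_. shift G))"

end

theory Submission
  imports Defs
begin

text \<open>
  (i) To a finite open partition \<open>P\<close> of \<open>X\<close> belongs the shift of finite type of all \<open>u : G \<rightarrow> P\<close> such that
  every \<open>u(g)\<close> contains a point mapped into \<open>u(sg)\<close> by \<open>\<Phi>\<^sub>s\<close> for all \<open>s \<in> S\<close> simultaneously. Choosing such
  points turns \<open>u\<close> into a pseudo-orbit. Partitions are directed by refinement, and shadowing says
  that for fine \<open>Q\<close> the image in the shift of \<open>P\<close> consists of itineraries of true orbits. As true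
  itineraries lift to every finer partition, this is the Mittag-Leffler condition, and by compactness
  the itinerary map identifies \<open>X\<close> with the inverse limit.

  (ii) A cover of the limit is refined by the preimage of finitely many open sets of one factor
  \<open>Y\<^sub>i\<close>. If \<open>\<phi>\<^sub>i\<^sub>j(Y\<^sub>j)\<close> is the stable image, it equals the image of the limit, so the sets pull back to a
  cover of \<open>Y\<^sub>j\<close>; a point of \<open>Y\<^sub>j\<close> shadowing the projected pseudo-orbit agrees in \<open>Y\<^sub>i\<close> with a point of the limit.
\<close>

section \<open>Directed families\<close>

lemma directed_set_finite_upper_bound:
  assumes "directed_set \<Lambda> R" and "finite F" and "F \<subseteq> \<Lambda>"
  shows "\<exists>k\<in>\<Lambda>. \<forall>i\<in>F. (i, k) \<in> R"
  using assms(2,3)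
proof (induction F rule: finite_induct)
  case empty
  then show ?case using assms(1) by (auto simp: directed_set_def)
next
  case (insert a F)
  then obtain k where "k \<in> \<Lambda>" "\<forall>i\<in>F. (i, k) \<in> R" by auto
  moreover from this insert obtain l where "l \<in> \<Lambda>" "(k, l) \<in> R" "(a, l) \<in> R"
    using assms(1) unfolding directed_set_def by (metis insert_subset)
  moreover have "trans R"
    using assms(1) by (simp add: directed_set_def preorder_on_def)
  ultimately show ?case by (metis insert_iff transD)
qed

lemma directed_set_memD:
  assumes "directed_set \<Lambda> R" and "(i, j) \<in> R"
  shows "i \<in> \<Lambda>" and "j \<in> \<Lambda>"
  using assms by (auto simp: directed_set_def preorder_on_def)

lemma directed_set_refl: "directed_set \<Lambda> R \<Longrightarrow> i \<in> \<Lambda> \<Longrightarrow> (i, i) \<in> R"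
  by (auto simp: directed_set_def preorder_on_def refl_on_def)

lemma directed_set_trans: "directed_set \<Lambda> R \<Longrightarrow> (i, j) \<in> R \<Longrightarrow> (j, k) \<in> R \<Longrightarrow> (i, k) \<in> R"
  unfolding directed_set_def preorder_on_def by (blast dest: transD)

text \<open>Any finite intersection contains \<open>K k\<close> for an upper bound \<open>k\<close>
  of the indices involved, hence is nonempty, and the finite intersection property applies. Both
  compactness arguments below, lifting a stable point to the limit and realizing a thread of symbol
  sequences by a point, have this form.\<close>

lemma compact_space_directed_Inter:
  assumes "compact_space X" and dir: "directed_set \<Lambda> R"
    and closed: "\<And>i. i \<in> \<Lambda> \<Longrightarrow> closedin X (K i)"
    and ne: "\<And>i. i \<in> \<Lambda> \<Longrightarrow> K i \<noteq> {}"
    and anti: "\<And>i j. (i, j) \<in> R \<Longrightarrow> K j \<subseteq> K i"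
  shows "(\<Inter>i\<in>\<Lambda>. K i) \<noteq> {}"
proof -
  have "\<Inter>\<F> \<noteq> {}" if "finite \<F>" "\<F> \<subseteq> K ` \<Lambda>" for \<F>
  proof -
    obtain F where F: "finite F" "F \<subseteq> \<Lambda>" "\<F> = K ` F"
      using \<open>finite \<F>\<close> \<open>\<F> \<subseteq> K ` \<Lambda>\<close> by (meson finite_subset_image)
    then obtain k where "k \<in> \<Lambda>" "\<forall>i\<in>F. (i, k) \<in> R"
      using directed_set_finite_upper_bound[OF dir] by blast
    then have "K k \<subseteq> \<Inter>\<F>" using anti F(3) by blast
    then show ?thesis using ne[OF \<open>k \<in> \<Lambda>\<close>] by blast
  qed
  then show ?thesis
    using \<open>compact_space X\<close>[unfolded compact_space_fip, rule_format, of "K ` \<Lambda>"] closed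
    by blast
qed


section \<open>Subshifts as dynamical systems\<close>

lemma topspace_full_shift: "topspace (full_shift G \<Sigma>) = carrier G \<rightarrow>\<^sub>E \<Sigma>"
  by (simp add: full_shift_def)

lemma continuous_map_full_shift_coordinate:
  "g \<in> carrier G \<Longrightarrow> continuous_map (full_shift G \<Sigma>) (discrete_topology \<Sigma>) (\<lambda>x. x g)"
  unfolding full_shift_def by (rule continuous_map_product_projection)

lemma continuous_map_to_full_shift:
  assumes "\<And>x. x \<in> topspace X \<Longrightarrow> f x \<in> extensional (carrier G)"
    and "\<And>g. g \<in> carrier G \<Longrightarrow> continuous_map X (discrete_topology \<Sigma>) (\<lambda>x. f x g)"
  shows "continuous_map X (full_shift G \<Sigma>) f"
  unfolding full_shift_def continuous_map_componentwise using assms by blast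

lemma continuous_map_to_discrete:
  assumes "\<And>x. x \<in> topspace X \<Longrightarrow> f x \<in> D"
    and "\<And>d. d \<in> D \<Longrightarrow> openin X {x \<in> topspace X. f x = d}"
  shows "continuous_map X (discrete_topology D) f"
  unfolding continuous_map
proof (intro conjI allI impI)
  show "f ` topspace X \<subseteq> topspace (discrete_topology D)" using assms(1) by auto
next
  fix U assume "openin (discrete_topology D) U"
  then have "openin X (\<Union>d\<in>U. {x \<in> topspace X. f x = d})"
    using assms(2) by (intro openin_Union) auto
  moreover have "(\<Union>d\<in>U. {x \<in> topspace X. f x = d}) = {x \<in> topspace X. f x \<in> U}" by blast
  ultimately show "openin X {x \<in> topspace X. f x \<in> U}" by simp
qed

lemma Hausdorff_space_subshift_space: "Hausdorff_space (subshift_space G \<Sigma> Y)"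
  unfolding full_shift_def
  by (intro Hausdorff_space_subtopology) (simp add: Hausdorff_space_product_topology)

lemma compact_space_subshift_space:
  assumes "subshift G \<Sigma> Y"
  shows "compact_space (subshift_space G \<Sigma> Y)"
proof -
  have "compact_space (full_shift G \<Sigma>)"
    using assms
    by (auto simp: subshift_def full_shift_def compact_space_product_topology
        compact_space_discrete_topology)
  then show ?thesis
    using assms closedin_compact_space compact_space_subtopology by (metis subshift_def)
qed

lemma topspace_subshift_space:
  assumes "subshift G \<Sigma> Y"
  shows "topspace (subshift_space G \<Sigma> Y) = Y"
  using assms closedin_subset by (fastforce simp: subshift_def)

section \<open>The shift action\<close>

context group
begin

lemma shift_in_PiE:
  assumes "g \<in> carrier G" and "x \<in> carrier G \<rightarrow>\<^sub>E \<Sigma>"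
  shows "shift G g x \<in> carrier G \<rightarrow>\<^sub>E \<Sigma>"
  using assms by (auto simp: shift_def PiE_iff)

lemma shift_shift:
  assumes "g \<in> carrier G" and "h \<in> carrier G"
  shows "shift G g (shift G h x) = shift G (g \<otimes> h) x"
  using assms by (auto simp: shift_def m_assoc fun_eq_iff)

lemma shift_one: "x \<in> extensional (carrier G) \<Longrightarrow> shift G \<one> x = x"
  by (auto simp: shift_def fun_eq_iff extensional_def)

lemma continuous_map_shift:
  assumes "g \<in> carrier G"
  shows "continuous_map (full_shift G \<Sigma>) (full_shift G \<Sigma>) (shift G g)"
proof (rule continuous_map_to_full_shift)
  fix h assume h: "h \<in> carrier G"
  show "continuous_map (full_shift G \<Sigma>) (discrete_topology \<Sigma>) (\<lambda>x. shift G g x h)"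
    using continuous_map_full_shift_coordinate[of "h \<otimes> g" G \<Sigma>] assms h by (simp add: shift_def)
qed (simp add: shift_def)

lemma dynamical_system_subshift:
  assumes "subshift G \<Sigma> Y"
  shows "dynamical_system G (subshift_space G \<Sigma> Y) (shift G)"
proof -
  let ?Y = "subshift_space G \<Sigma> Y"
  \<comment> \<open>\<open>shift\<close> always returns a function that is \<open>undefined\<close>
    off the group, so \<open>\<one>\<close> acts as the identity only on extensional
    functions.\<close>
  have ext: "y \<in> extensional (carrier G)" if "y \<in> Y" for y
    using that topspace_subshift_space[OF assms]
    by (auto simp: topspace_full_shift PiE_def)
  have cont: "continuous_map ?Y ?Y (shift G g)" if "g \<in> carrier G" for g
    using assms that topspace_subshift_space[OF assms]
    by (intro continuous_map_into_subtopology[OF continuous_map_from_subtopology]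
        continuous_map_shift) (auto simp: subshift_def)
  have "homeomorphic_map ?Y ?Y (shift G g)" if g: "g \<in> carrier G" for g
  proof -
    have "homeomorphic_maps ?Y ?Y (shift G g) (shift G (inv g))"
      unfolding homeomorphic_maps_def topspace_subshift_space[OF assms]
      using g cont ext by (simp add: shift_shift shift_one)
    then show ?thesis by (rule homeomorphic_maps_imp_map)
  qed
  then show ?thesis
    unfolding dynamical_system_def topspace_subshift_space[OF assms]
    using compact_space_subshift_space[OF assms] Hausdorff_space_subshift_space ext
    by (auto simp: shift_shift shift_one)
qed

text \<open>A cylinder over a finite window is open, so forbidding it at every position removes a
  union of open sets. Invariance holds because the condition ranges over all positions.\<close>

lemma subshift_forbidden_patterns:
  assumes "finite \<Sigma>" and "finite A" and "A \<subseteq> carrier G"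
  shows "subshift G \<Sigma> {x \<in> carrier G \<rightarrow>\<^sub>E \<Sigma>.
           \<forall>g\<in>carrier G. \<forall>P\<in>\<F>. shift G g x \<notin> cylinder G \<Sigma> A P}" (is "subshift G \<Sigma> ?Y")
  unfolding subshift_def
proof (intro conjI ballI)
  have cyl: "openin (full_shift G \<Sigma>) (cylinder G \<Sigma> A P)" for P
  proof -
    \<comment> \<open>Intersecting with \<open>\<Sigma>\<close> keeps the set open in the discrete
      alphabet even if \<open>P a\<close> is not a letter. The factor \<open>topspace\<close> below
      covers an empty window, whose intersection would be \<open>UNIV\<close>.\<close>
    have "openin (full_shift G \<Sigma>) {x \<in> topspace (full_shift G \<Sigma>). x a \<in> {P a} \<inter> \<Sigma>}"
      if "a \<in> A" for a
      by (rule openin_continuous_map_preimage[OF continuous_map_full_shift_coordinate])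
        (use that assms in auto)
    then have "openin (full_shift G \<Sigma>)
        ((\<Inter>a\<in>A. {x \<in> topspace (full_shift G \<Sigma>). x a \<in> {P a} \<inter> \<Sigma>}) \<inter> topspace (full_shift G \<Sigma>))"
      using \<open>finite A\<close> by (intro openin_INT) auto
    also have "(\<Inter>a\<in>A. {x \<in> topspace (full_shift G \<Sigma>). x a \<in> {P a} \<inter> \<Sigma>}) \<inter> topspace (full_shift G \<Sigma>)
        = cylinder G \<Sigma> A P"
      using assms by (auto simp: cylinder_def topspace_full_shift PiE_iff extensional_def)
    finally show ?thesis .
  qed
  have "openin (full_shift G \<Sigma>)
      (\<Union>g\<in>carrier G. \<Union>P\<in>\<F>. {x \<in> topspace (full_shift G \<Sigma>). shift G g x \<in> cylinder G \<Sigma> A P})"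
    by (intro openin_Union ballI)
      (auto intro!: openin_Union openin_continuous_map_preimage[OF continuous_map_shift] cyl)
  moreover have "?Y = topspace (full_shift G \<Sigma>) -
      (\<Union>g\<in>carrier G. \<Union>P\<in>\<F>. {x \<in> topspace (full_shift G \<Sigma>). shift G g x \<in> cylinder G \<Sigma> A P})"
    by (auto simp: topspace_full_shift)
  ultimately show "closedin (full_shift G \<Sigma>) ?Y"
    by (simp only: closedin_diff closedin_topspace)
next
  fix g x assume "g \<in> carrier G" "x \<in> ?Y"
  then show "shift G g x \<in> ?Y" by (auto simp: shift_in_PiE shift_shift)
qed (rule assms(1))

end


section \<open>Inverse limits\<close>

lemma inverse_systemD:
  assumes "inverse_system G \<Lambda> R Y \<Psi> \<phi>"
  shows "directed_set \<Lambda> R"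
    and "i \<in> \<Lambda> \<Longrightarrow> compact_space (Y i)"
    and "i \<in> \<Lambda> \<Longrightarrow> Hausdorff_space (Y i)"
    and "(i, j) \<in> R \<Longrightarrow> continuous_map (Y j) (Y i) (\<phi> i j)"
    and "(i, j) \<in> R \<Longrightarrow> y \<in> topspace (Y j) \<Longrightarrow> \<phi> i j y \<in> topspace (Y i)"
    and "i \<in> \<Lambda> \<Longrightarrow> y \<in> topspace (Y i) \<Longrightarrow> \<phi> i i y = y"
    and "(i, j) \<in> R \<Longrightarrow> (j, k) \<in> R \<Longrightarrow> z \<in> topspace (Y k) \<Longrightarrow> \<phi> i j (\<phi> j k z) = \<phi> i k z"
    and "(i, j) \<in> R \<Longrightarrow> g \<in> carrier G \<Longrightarrow> y \<in> topspace (Y j) \<Longrightarrow> \<phi> i j (\<Psi> j g y) = \<Psi> i g (\<phi> i j y)"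
proof -
  show "(i, j) \<in> R \<Longrightarrow> y \<in> topspace (Y j) \<Longrightarrow> \<phi> i j y \<in> topspace (Y i)"
    using assms continuous_map_image_subset_topspace[of "Y j" "Y i" "\<phi> i j"]
    unfolding inverse_system_def by blast
qed (use assms in \<open>simp_all add: inverse_system_def dynamical_system_def\<close>)

lemma topspace_inverse_limit:
  "topspace (inverse_limit \<Lambda> R Y \<phi>) =
     {x \<in> \<Pi>\<^sub>E i\<in>\<Lambda>. topspace (Y i). \<forall>i j. (i, j) \<in> R \<longrightarrow> x i = \<phi> i j (x j)}"
  by (auto simp: inverse_limit_def)

lemma continuous_map_inverse_limit_projection:
  "i \<in> \<Lambda> \<Longrightarrow> continuous_map (inverse_limit \<Lambda> R Y \<phi>) (Y i) (\<lambda>x. x i)"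
  unfolding inverse_limit_def
  by (intro continuous_map_from_subtopology continuous_map_product_projection)

lemma Hausdorff_space_inverse_limit:
  assumes "\<And>i. i \<in> \<Lambda> \<Longrightarrow> Hausdorff_space (Y i)"
  shows "Hausdorff_space (inverse_limit \<Lambda> R Y \<phi>)"
  unfolding inverse_limit_def using assms
  by (intro Hausdorff_space_subtopology) (simp add: Hausdorff_space_product_topology)

text \<open>A basic open set of the product constrains finitely many coordinates. An index
  \<open>k\<close> above all of them determines these coordinates on the limit, so one open
  condition on coordinate \<open>k\<close> suffices.\<close>

lemma inverse_limit_basis:
  assumes sys: "inverse_system G \<Lambda> R Y \<Psi> \<phi>"
    and "openin (inverse_limit \<Lambda> R Y \<phi>) U" and "x \<in> U"
  shows "\<exists>i\<in>\<Lambda>. \<exists>V. openin (Y i) V \<and> x i \<in> V \<and>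
           {y \<in> topspace (inverse_limit \<Lambda> R Y \<phi>). y i \<in> V} \<subseteq> U"
proof -
  note D = inverse_systemD[OF sys]
  obtain T where T: "openin (product_topology Y \<Lambda>) T"
    and U: "U = T \<inter> {x. \<forall>i j. (i, j) \<in> R \<longrightarrow> x i = \<phi> i j (x j)}"
    using assms(2) by (auto simp: inverse_limit_def openin_subtopology)
  have comp: "\<And>i j. (i, j) \<in> R \<Longrightarrow> x i = \<phi> i j (x j)" using U \<open>x \<in> U\<close> by blast
  have "x \<in> T" using U \<open>x \<in> U\<close> by blast
  then obtain W where W: "finite {i \<in> \<Lambda>. W i \<noteq> topspace (Y i)}" "\<And>i. i \<in> \<Lambda> \<Longrightarrow> openin (Y i) (W i)"
      "x \<in> Pi\<^sub>E \<Lambda> W" "Pi\<^sub>E \<Lambda> W \<subseteq> T"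
    using T[unfolded openin_product_topology_alt, rule_format, of x] by auto
  let ?F = "{i \<in> \<Lambda>. W i \<noteq> topspace (Y i)}"
  obtain k where k: "k \<in> \<Lambda>" "\<forall>i\<in>?F. (i, k) \<in> R"
    using directed_set_finite_upper_bound[OF D(1) W(1)] by auto
  \<comment> \<open>All constraints are pulled back to the factor \<open>k\<close>; the intersection
    with \<open>topspace (Y k)\<close> covers the case that there are none.\<close>
  define V where "V = (\<Inter>i\<in>?F. {y \<in> topspace (Y k). \<phi> i k y \<in> W i}) \<inter> topspace (Y k)"
  have "openin (Y k) V"
    unfolding V_def
    by (intro openin_INT W(1) openin_continuous_map_preimage[OF D(4)]) (use k W(2) in auto)
  moreover have "x k \<in> V"
  proof -
    have "x k \<in> topspace (Y k)"
      using PiE_mem[OF W(3) k(1)] openin_subset[OF W(2)[OF k(1)]] by blast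
    moreover have "\<phi> i k (x k) \<in> W i" if "i \<in> ?F" for i
      using that W(3) comp[of i k] k(2) by (auto simp: PiE_iff)
    ultimately show ?thesis by (simp add: V_def)
  qed
  moreover have "{y \<in> topspace (inverse_limit \<Lambda> R Y \<phi>). y k \<in> V} \<subseteq> U"
  proof
    fix y assume "y \<in> {y \<in> topspace (inverse_limit \<Lambda> R Y \<phi>). y k \<in> V}"
    then have y: "y \<in> (\<Pi>\<^sub>E i\<in>\<Lambda>. topspace (Y i))" "\<forall>i j. (i, j) \<in> R \<longrightarrow> y i = \<phi> i j (y j)" "y k \<in> V"
      by (auto simp: topspace_inverse_limit)
    have "y i \<in> W i" if "i \<in> \<Lambda>" for i
    proof (cases "i \<in> ?F")
      case True
      then have "\<phi> i k (y k) \<in> W i" using y(3) by (simp add: V_def)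
      then show ?thesis using y(2) k(2) True by metis
    next
      case False
      then show ?thesis using y(1) that by auto
    qed
    then have "y \<in> Pi\<^sub>E \<Lambda> W" using y(1) by (auto simp: PiE_iff)
    then show "y \<in> U" using W(4) U y(2) by blast
  qed
  ultimately show ?thesis using k(1) by blast
qed

text \<open>A point \<open>p\<close> of the stable image has preimages in arbitrarily late factors,
  and compactness of the product combines these partial lifts into one thread. This is how the
  Mittag-Leffler condition replaces surjectivity of the bonding maps.\<close>

lemma stable_image_subset_inverse_limit_image:
  assumes sys: "inverse_system G \<Lambda> R Y \<Psi> \<phi>" and ij: "(i, j) \<in> R"
    and stable: "\<And>k. (j, k) \<in> R \<Longrightarrow> \<phi> i k ` topspace (Y k) = \<phi> i j ` topspace (Y j)"
  shows "\<phi> i j ` topspace (Y j) \<subseteq> (\<lambda>x. x i) ` topspace (inverse_limit \<Lambda> R Y \<phi>)"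
proof
  note D = inverse_systemD[OF sys]
  note dir = D(1)
  let ?P = "product_topology Y \<Lambda>"
  fix p assume p: "p \<in> \<phi> i j ` topspace (Y j)"
  have iL: "i \<in> \<Lambda>" using directed_set_memD[OF dir ij] by blast
  have pY: "p \<in> topspace (Y i)" using p D(5)[OF ij] by blast
  \<comment> \<open>Take \<open>m\<close> above both \<open>k\<close> and \<open>j\<close>; by
    stability the image of \<open>Y m\<close> in \<open>Y i\<close> still contains
    \<open>p\<close>.\<close>
  have lift: "\<exists>m\<in>\<Lambda>. (k, m) \<in> R \<and> (i, m) \<in> R \<and> (\<exists>y\<in>topspace (Y m). \<phi> i m y = p)"
    if k: "k \<in> \<Lambda>" for k
  proof -
    obtain m where m: "m \<in> \<Lambda>" "(k, m) \<in> R" "(j, m) \<in> R"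
      using dir k directed_set_memD[OF dir ij] unfolding directed_set_def by meson
    then show ?thesis using stable[OF m(3)] p directed_set_trans[OF dir ij m(3)]
      by (metis imageE)
  qed
  \<comment> \<open>Points of the full product that have coordinate \<open>p\<close> at
    \<open>i\<close> and are consistent with coordinate \<open>k\<close> at all indices below
    \<open>k\<close>. The intersection of all \<open>K k\<close> is the fibre of the inverse limit
    over \<open>p\<close>.\<close>
  define K where "K k = {x \<in> topspace ?P. x i = p} \<inter>
      (\<Inter>l\<in>{l \<in> \<Lambda>. (l, k) \<in> R}. {x \<in> topspace ?P. x l = \<phi> l k (x k)})" for k
  have ne: "topspace (Y k) \<noteq> {}" if "k \<in> \<Lambda>" for k
    using lift[OF that] D(5) by blast
  have "compact_space ?P" using D(2) by (auto simp: compact_space_product_topology)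
  moreover have "closedin ?P (K k)" if k: "k \<in> \<Lambda>" for k
    unfolding K_def
  proof (intro closedin_Int closedin_INT)
    show "closedin ?P {x \<in> topspace ?P. x i = p}"
      by (rule closedin_continuous_maps_eq[OF D(3)[OF iL]])
        (use iL pY in \<open>auto intro: continuous_map_product_projection\<close>)
    show "{l \<in> \<Lambda>. (l, k) \<in> R} \<noteq> {}" using directed_set_refl[OF dir k] k by blast
    fix l assume l: "l \<in> {l \<in> \<Lambda>. (l, k) \<in> R}"
    have "continuous_map ?P (Y l) (\<phi> l k \<circ> (\<lambda>x. x k))"
      by (rule continuous_map_compose[OF continuous_map_product_projection[OF k] D(4)])
        (use l in auto)
    then show "closedin ?P {x \<in> topspace ?P. x l = \<phi> l k (x k)}"
      using l closedin_continuous_maps_eq[of "Y l" ?P "\<lambda>x. x l" "\<phi> l k \<circ> (\<lambda>x. x k)"]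
        D(3) continuous_map_product_projection[of l \<Lambda> Y]
      by simp
  qed
  moreover have "K k \<noteq> {}" if k: "k \<in> \<Lambda>" for k
  proof -
    obtain m y where m: "m \<in> \<Lambda>" "(k, m) \<in> R" "(i, m) \<in> R" and y: "y \<in> topspace (Y m)" "\<phi> i m y = p"
      using lift[OF k] by blast
    \<comment> \<open>Coordinates below \<open>m\<close> are the images of the lift
      \<open>y\<close>; the others are arbitrary, which is possible because all factors are
      nonempty.\<close>
    define x where
      "x = (\<lambda>l\<in>\<Lambda>. if (l, m) \<in> R then \<phi> l m y else (SOME z. z \<in> topspace (Y l)))"
    have "x \<in> topspace ?P"
      using D(5)[OF _ y(1)] ne by (auto simp: x_def PiE_iff some_in_eq)
    moreover have "x l = \<phi> l k (x k)" if "l \<in> \<Lambda>" "(l, k) \<in> R" for l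
      using that D(7)[OF that(2) m(2) y(1)] m(2) k directed_set_trans[OF dir that(2) m(2)]
      by (simp add: x_def)
    moreover have "x i = p" using iL m(3) y(2) by (simp add: x_def)
    ultimately have "x \<in> K k" by (auto simp: K_def)
    then show ?thesis by blast
  qed
  moreover have "K k \<subseteq> K l" if lk: "(l, k) \<in> R" for l k
  proof
    fix x assume x: "x \<in> K k"
    have "l \<in> \<Lambda>" "k \<in> \<Lambda>" using directed_set_memD[OF dir lk] by auto
    then have xk: "x k \<in> topspace (Y k)" using x by (auto simp: K_def)
    have *: "x n = \<phi> n k (x k)" if "(n, k) \<in> R" for n
      using x that directed_set_memD[OF dir that] by (auto simp: K_def)
    have "x n = \<phi> n l (x l)" if "(n, l) \<in> R" for n
      using *[OF directed_set_trans[OF dir that lk]] *[OF lk] D(7)[OF that lk xk] by simp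
    then show "x \<in> K l" using x by (auto simp: K_def)
  qed
  ultimately have "(\<Inter>k\<in>\<Lambda>. K k) \<noteq> {}" by (rule compact_space_directed_Inter[OF _ dir])
  then obtain x where x: "x \<in> K k" if "k \<in> \<Lambda>" for k by blast
  have "x \<in> topspace (inverse_limit \<Lambda> R Y \<phi>)"
  proof -
    have "x \<in> (\<Pi>\<^sub>E i\<in>\<Lambda>. topspace (Y i))" using x[OF iL] by (simp add: K_def)
    moreover have "x k = \<phi> k l (x l)" if "(k, l) \<in> R" for k l
      using x[of l] directed_set_memD[OF dir that] that by (auto simp: K_def)
    ultimately show ?thesis by (simp add: topspace_inverse_limit)
  qed
  moreover have "x i = p" using x[OF iL] by (simp add: K_def)
  ultimately show "p \<in> (\<lambda>x. x i) ` topspace (inverse_limit \<Lambda> R Y \<phi>)" by blast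
qed


section \<open>Shadowing from approximating maps\<close>

text \<open>Compactness selects finitely many basic sets, each given by a condition on some factor
  and contained in a member of \<open>\<U>\<close>. One index \<open>k\<close> above these factors
  carries all the conditions. Working with maps \<open>p i\<close> out of \<open>X\<close> instead
  of an actual inverse limit lets the conjugacy be absorbed into the maps.\<close>

lemma finite_open_cover_refined_by_preimages:
  assumes "compact_space X"
    and sys: "inverse_system G \<Lambda> R Y \<Psi> \<phi>"
    and cont: "\<And>i. i \<in> \<Lambda> \<Longrightarrow> continuous_map X (Y i) (p i)"
    and compat: "\<And>i j x. (i, j) \<in> R \<Longrightarrow> x \<in> topspace X \<Longrightarrow> p i x = \<phi> i j (p j x)"
    and basis: "\<And>U x. openin X U \<Longrightarrow> x \<in> U \<Longrightarrow>
      \<exists>i\<in>\<Lambda>. \<exists>V. openin (Y i) V \<and> p i x \<in> V \<and> {y \<in> topspace X. p i y \<in> V} \<subseteq> U"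
    and cover: "finite_open_cover X \<U>"
  shows "\<exists>k\<in>\<Lambda>. \<exists>\<O>. finite \<O> \<and> p k ` topspace X \<subseteq> \<Union>\<O> \<and>
      (\<forall>V\<in>\<O>. openin (Y k) V \<and> (\<exists>U\<in>\<U>. {x \<in> topspace X. p k x \<in> V} \<subseteq> U))"
proof -
  note D = inverse_systemD[OF sys]
  \<comment> \<open>The pairs of an index and an open set of that factor whose preimage in
    \<open>X\<close> fits into one member of \<open>\<U>\<close>.\<close>
  define good where "good = (\<lambda>(i, V). i \<in> \<Lambda> \<and> openin (Y i) V \<and>
      (\<exists>U\<in>\<U>. {x \<in> topspace X. p i x \<in> V} \<subseteq> U))"
  define pre where "pre = (\<lambda>(i, V). {x \<in> topspace X. p i x \<in> V})"
  have "openin X C" if "C \<in> pre ` Collect good" for C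
    using that openin_continuous_map_preimage[OF cont] by (auto simp: good_def pre_def)
  moreover have "topspace X \<subseteq> \<Union>(pre ` Collect good)"
  proof
    fix x assume x: "x \<in> topspace X"
    then obtain U where U: "U \<in> \<U>" "x \<in> U" "openin X U"
      using cover by (auto simp: finite_open_cover_def)
    then obtain i V where "i \<in> \<Lambda>" "openin (Y i) V" "p i x \<in> V" "{y \<in> topspace X. p i y \<in> V} \<subseteq> U"
      using basis by meson
    then have "good (i, V)" "x \<in> pre (i, V)" using U(1) x by (auto simp: good_def pre_def)
    then show "x \<in> \<Union>(pre ` Collect good)" by blast
  qed
  ultimately obtain \<F> where "finite \<F>" "\<F> \<subseteq> pre ` Collect good" "topspace X \<subseteq> \<Union>\<F>"
    using \<open>compact_space X\<close> unfolding compact_space_alt by meson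
  then obtain F where F: "finite F" "F \<subseteq> Collect good" "topspace X \<subseteq> \<Union>(pre ` F)"
    by (metis finite_subset_image)
  have "fst ` F \<subseteq> \<Lambda>" using F(2) by (auto simp: good_def)
  then obtain k where k: "k \<in> \<Lambda>" "\<forall>i\<in>fst ` F. (i, k) \<in> R"
    using directed_set_finite_upper_bound[OF D(1) finite_imageI[OF F(1)]] by blast
  \<comment> \<open>Moves a condition from factor \<open>i\<close> to factor \<open>k\<close>; by
    \<open>compat\<close> its preimage in \<open>X\<close> stays the same.\<close>
  define pull where "pull = (\<lambda>(i, V). {y \<in> topspace (Y k). \<phi> i k y \<in> V})"
  have pull_iff: "p k x \<in> pull c \<longleftrightarrow> x \<in> pre c" if "x \<in> topspace X" "c \<in> F" for x c
    using that k compat[of "fst c" k x] continuous_map_image_subset_topspace[OF cont[OF k(1)]]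
    by (auto simp: pull_def pre_def split: prod.splits)
  have "p k ` topspace X \<subseteq> \<Union>(pull ` F)"
    using F(3) pull_iff by blast
  moreover have "openin (Y k) (pull c)" if "c \<in> F" for c
    using that k(2) F(2) openin_continuous_map_preimage[OF D(4), of "fst c" k "snd c"]
    by (auto simp: pull_def good_def split: prod.splits)
  moreover have "\<exists>U\<in>\<U>. {x \<in> topspace X. p k x \<in> pull c} \<subseteq> U" if "c \<in> F" for c
  proof -
    have "good c" using F(2) that by blast
    then obtain U where "U \<in> \<U>" "pre c \<subseteq> U"
      by (cases c) (auto simp: good_def pre_def)
    then show ?thesis using pull_iff[OF _ that] by blast
  qed
  ultimately show ?thesis using k(1) F(1)
    by (intro bexI[of _ k] exI[of _ "pull ` F"]) auto
qed

text \<open>Empty preimages must be deleted because members of a finite open cover are nonempty; the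
  union is unaffected.\<close>

lemma finite_open_cover_preimages:
  assumes "continuous_map X Y f" and "finite \<O>" and "\<And>V. V \<in> \<O> \<Longrightarrow> openin Y V"
    and "f ` topspace X \<subseteq> \<Union>\<O>"
  shows "finite_open_cover X ((\<lambda>V. {x \<in> topspace X. f x \<in> V}) ` \<O> - {{}})"
proof -
  have "x \<in> \<Union>((\<lambda>V. {x \<in> topspace X. f x \<in> V}) ` \<O> - {{}})" if "x \<in> topspace X" for x
  proof -
    obtain V where "V \<in> \<O>" "f x \<in> V" using assms(4) \<open>x \<in> topspace X\<close> by blast
    then show ?thesis using \<open>x \<in> topspace X\<close> by blast
  qed
  then show ?thesis
    using assms(2,3) openin_continuous_map_preimage[OF assms(1)]
    unfolding finite_open_cover_def by auto
qed

section \<open>Transfer of shadowing along equivariant maps\<close>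

context group
begin

text \<open>Each set used by the given pseudo-orbit is the preimage of some member of
  \<open>\<V>\<close>. Choosing one such member per group element gives the family required in
  \<open>Y\<close>, and equivariance carries \<open>\<Phi> s (x g)\<close> to
  \<open>\<Psi> s (f (x g))\<close>.\<close>

lemma pseudo_orbit_image:
  assumes cont: "continuous_map X Y f" and S: "S \<subseteq> carrier G"
    and maps: "\<And>g x. g \<in> carrier G \<Longrightarrow> x \<in> topspace X \<Longrightarrow> \<Phi> g x \<in> topspace X"
    and equi: "\<And>g x. g \<in> carrier G \<Longrightarrow> x \<in> topspace X \<Longrightarrow> f (\<Phi> g x) = \<Psi> g (f x)"
    and po: "pseudo_orbit G X \<Phi> S ((\<lambda>V. {x \<in> topspace X. f x \<in> V}) ` \<V> - {{}}) x"
  shows "pseudo_orbit G Y \<Psi> S \<V> (\<lambda>g. f (x g))"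
proof -
  have x: "x g \<in> topspace X" if "g \<in> carrier G" for g
    using po that by (simp add: pseudo_orbit_def)
  obtain U where U: "\<forall>g\<in>carrier G. U g \<in> (\<lambda>V. {x \<in> topspace X. f x \<in> V}) ` \<V>"
    and hit: "\<forall>g\<in>carrier G. \<forall>s\<in>S. x (s \<otimes> g) \<in> U (s \<otimes> g) \<and> \<Phi> s (x g) \<in> U (s \<otimes> g)"
    using po unfolding pseudo_orbit_def by blast
  have "\<forall>g\<in>carrier G. \<exists>V\<in>\<V>. U g = {x \<in> topspace X. f x \<in> V}" using U by blast
  then obtain V where V: "\<forall>g\<in>carrier G. V g \<in> \<V> \<and> U g = {x \<in> topspace X. f x \<in> V g}"
    by metis
  show ?thesis
    unfolding pseudo_orbit_def
  proof (intro conjI ballI exI[of _ V])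
    fix g assume g: "g \<in> carrier G"
    then show "f (x g) \<in> topspace Y"
      using x continuous_map_image_subset_topspace[OF cont] by blast
    fix s assume s: "s \<in> S"
    then have sg: "s \<in> carrier G" "s \<otimes> g \<in> carrier G" using S g by auto
    have "x (s \<otimes> g) \<in> U (s \<otimes> g)" "\<Phi> s (x g) \<in> U (s \<otimes> g)"
      using hit g s by auto
    then show "f (x (s \<otimes> g)) \<in> V (s \<otimes> g)" and "\<Psi> s (f (x g)) \<in> V (s \<otimes> g)"
      using V sg(2) by (auto simp flip: equi[OF sg(1) x[OF g]])
  qed (use V in blast)
qed

text \<open>Two levels are needed: accuracy is measured in \<open>Y i\<close>, but shadowing is used
  in a later \<open>Y j\<close> whose image in \<open>Y i\<close> consists of images of points of
  \<open>X\<close>. The shadowing point of \<open>Y j\<close> need not come from \<open>X\<close>;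
  only its image in \<open>Y i\<close> does, and that is all the cover \<open>\<O>\<close>
  sees.\<close>

lemma shadowing_property_approximation:
  assumes X: "dynamical_system G X \<Phi>" and S: "S \<subseteq> carrier G"
    and sys: "inverse_system G \<Lambda> R Y \<Psi> \<phi>"
    and cont: "\<And>i. i \<in> \<Lambda> \<Longrightarrow> continuous_map X (Y i) (p i)"
    and equi: "\<And>i g x. i \<in> \<Lambda> \<Longrightarrow> g \<in> carrier G \<Longrightarrow> x \<in> topspace X \<Longrightarrow> p i (\<Phi> g x) = \<Psi> i g (p i x)"
    and compat: "\<And>i j x. (i, j) \<in> R \<Longrightarrow> x \<in> topspace X \<Longrightarrow> p i x = \<phi> i j (p j x)"
    and basis: "\<And>U x. openin X U \<Longrightarrow> x \<in> U \<Longrightarrow>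
      \<exists>i\<in>\<Lambda>. \<exists>V. openin (Y i) V \<and> p i x \<in> V \<and> {y \<in> topspace X. p i y \<in> V} \<subseteq> U"
    and stable: "\<And>i. i \<in> \<Lambda> \<Longrightarrow> \<exists>j. (i, j) \<in> R \<and> \<phi> i j ` topspace (Y j) \<subseteq> p i ` topspace X"
    and shadowing: "\<And>i. i \<in> \<Lambda> \<Longrightarrow> shadowing_property G (Y i) (\<Psi> i) S"
  shows "shadowing_property G X \<Phi> S"
  unfolding shadowing_property_def
proof (intro allI impI)
  note D = inverse_systemD[OF sys]
  have maps: "\<Phi> g x \<in> topspace X" if "g \<in> carrier G" "x \<in> topspace X" for g x
    using X that homeomorphic_imp_surjective_map[of X X "\<Phi> g"] by (auto simp: dynamical_system_def)
  have compact: "compact_space X" using X by (simp add: dynamical_system_def)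
  fix \<U> assume cover: "finite_open_cover X \<U>"
  have "\<exists>i\<in>\<Lambda>. \<exists>\<O>. finite \<O> \<and> p i ` topspace X \<subseteq> \<Union>\<O> \<and>
      (\<forall>V\<in>\<O>. openin (Y i) V \<and> (\<exists>U\<in>\<U>. {x \<in> topspace X. p i x \<in> V} \<subseteq> U))"
    by (rule finite_open_cover_refined_by_preimages[OF compact sys cont compat basis cover])
  then obtain i \<O> where i: "i \<in> \<Lambda>" and "finite \<O>" and im: "p i ` topspace X \<subseteq> \<Union>\<O>"
    and \<O>: "\<forall>V\<in>\<O>. openin (Y i) V \<and> (\<exists>U\<in>\<U>. {x \<in> topspace X. p i x \<in> V} \<subseteq> U)"
    by (elim bexE exE conjE) (rule that)
  obtain j where ij: "(i, j) \<in> R" and imj: "\<phi> i j ` topspace (Y j) \<subseteq> p i ` topspace X"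
    using stable[OF i] by blast
  have j: "j \<in> \<Lambda>" using directed_set_memD[OF D(1) ij] by blast
  \<comment> \<open>\<open>\<O>\<close> is only known to cover the image of \<open>X\<close> in
    \<open>Y i\<close>, but the image of \<open>Y j\<close> lies inside that, so the preimages cover
    all of \<open>Y j\<close>.\<close>
  define \<Q> where "\<Q> = (\<lambda>V. {y \<in> topspace (Y j). \<phi> i j y \<in> V}) ` \<O> - {{}}"
  have "finite_open_cover (Y j) \<Q>"
    unfolding \<Q>_def
  proof (rule finite_open_cover_preimages[OF D(4)[OF ij] \<open>finite \<O>\<close>])
    show "\<phi> i j ` topspace (Y j) \<subseteq> \<Union>\<O>" using imj im by (rule subset_trans)
  qed (simp add: \<O>)
  then obtain \<V> where \<V>: "finite_open_cover (Y j) \<V>" and shadow: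
      "\<forall>x. pseudo_orbit G (Y j) (\<Psi> j) S \<V> x \<longrightarrow> (\<exists>z\<in>topspace (Y j). shadows G (\<Psi> j) \<Q> z x)"
    using shadowing[OF j, unfolded shadowing_property_def] by blast
  let ?\<W> = "(\<lambda>V. {x \<in> topspace X. p j x \<in> V}) ` \<V> - {{}}"
  have "finite_open_cover X ?\<W>"
    using \<V> continuous_map_image_subset_topspace[OF cont[OF j]]
    by (simp add: finite_open_cover_preimages[OF cont[OF j]] finite_open_cover_def[of "Y j"])
  moreover have "\<exists>z\<in>topspace X. shadows G \<Phi> \<U> z x" if po: "pseudo_orbit G X \<Phi> S ?\<W> x" for x
  proof -
    have x: "x g \<in> topspace X" if "g \<in> carrier G" for g
      using po that by (simp add: pseudo_orbit_def)
    have "pseudo_orbit G (Y j) (\<Psi> j) S \<V> (\<lambda>g. p j (x g))"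
      by (rule pseudo_orbit_image[OF cont[OF j] S maps equi[OF j] po])
    then obtain y where y: "y \<in> topspace (Y j)" and ysh: "shadows G (\<Psi> j) \<Q> y (\<lambda>g. p j (x g))"
      using shadow by blast
    \<comment> \<open>The point \<open>y\<close> is replaced by a point of \<open>X\<close> that is
      indistinguishable from it in \<open>Y i\<close>.\<close>
    obtain z where z: "z \<in> topspace X" "\<phi> i j y = p i z" using imj y by blast
    have "\<exists>U\<in>\<U>. \<Phi> g z \<in> U \<and> x g \<in> U" if g: "g \<in> carrier G" for g
    proof -
      obtain V where V: "V \<in> \<O>" "\<phi> i j (\<Psi> j g y) \<in> V" "\<phi> i j (p j (x g)) \<in> V"
        using ysh g unfolding shadows_def \<Q>_def by blast
      \<comment> \<open>Equivariance extends the agreement of \<open>y\<close> and \<open>z\<close>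
        in \<open>Y i\<close> from the points themselves to their whole orbits.\<close>
      have "p i (\<Phi> g z) \<in> V" "p i (x g) \<in> V"
        using V(2,3) by (simp_all add: D(8)[OF ij g y] z(2) equi[OF i g z(1)] compat[OF ij x[OF g]])
      moreover obtain U where "U \<in> \<U>" "{x \<in> topspace X. p i x \<in> V} \<subseteq> U"
        using \<O> V(1) by blast
      ultimately show ?thesis using maps[OF g z(1)] x[OF g] by blast
    qed
    then show ?thesis using z(1) by (auto simp: shadows_def)
  qed
  ultimately show "\<exists>\<V>. finite_open_cover X \<V> \<and>
      (\<forall>x. pseudo_orbit G X \<Phi> S \<V> x \<longrightarrow> (\<exists>z\<in>topspace X. shadows G \<Phi> \<U> z x))"
    by blast
qed

text \<open>The coordinates of the conjugacy \<open>h\<close> serve as the approximating maps. Since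
  \<open>h\<close> is onto the limit, the stable images are images of \<open>X\<close>.\<close>

lemma shadowing_property_conjugate_inverse_limit:
  assumes X: "dynamical_system G X \<Phi>" and S: "S \<subseteq> carrier G"
    and sys: "inverse_system G \<Lambda> R Y \<Psi> \<phi>" and ml: "mittag_leffler \<Lambda> R Y \<phi>"
    and shadowing: "\<And>i. i \<in> \<Lambda> \<Longrightarrow> shadowing_property G (Y i) (\<Psi> i) S"
    and conj: "conjugate G X \<Phi> (inverse_limit \<Lambda> R Y \<phi>) (inverse_limit_action \<Lambda> \<Psi>)"
  shows "shadowing_property G X \<Phi> S"
proof -
  let ?L = "inverse_limit \<Lambda> R Y \<phi>"
  obtain h where h: "homeomorphic_map X ?L h"
    and equi: "\<forall>g\<in>carrier G. \<forall>x\<in>topspace X. h (\<Phi> g x) = inverse_limit_action \<Lambda> \<Psi> g (h x)"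
    using conj by (auto simp: conjugate_def)
  have him: "h ` topspace X = topspace ?L" by (rule homeomorphic_imp_surjective_map[OF h])
  show ?thesis
  proof (rule shadowing_property_approximation[OF X S sys, of "\<lambda>i x. h x i"])
    fix i assume i: "i \<in> \<Lambda>"
    show "continuous_map X (Y i) (\<lambda>x. h x i)"
      using continuous_map_compose[OF homeomorphic_imp_continuous_map[OF h]
          continuous_map_inverse_limit_projection[OF i]] by (simp add: comp_def)
    show "shadowing_property G (Y i) (\<Psi> i) S" by (rule shadowing[OF i])
    show "h (\<Phi> g x) i = \<Psi> i g (h x i)" if "g \<in> carrier G" "x \<in> topspace X" for g x
      using equi that i by (simp add: inverse_limit_action_def)
    obtain j where j: "(i, j) \<in> R"
      "\<And>k. (j, k) \<in> R \<Longrightarrow> \<phi> i k ` topspace (Y k) = \<phi> i j ` topspace (Y j)"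
      using ml i unfolding mittag_leffler_def by blast
    have "\<phi> i j ` topspace (Y j) \<subseteq> (\<lambda>x. x i) ` h ` topspace X"
      unfolding him by (rule stable_image_subset_inverse_limit_image[OF sys j])
    then show "\<exists>j. (i, j) \<in> R \<and> \<phi> i j ` topspace (Y j) \<subseteq> (\<lambda>x. h x i) ` topspace X"
      using j(1) by (auto simp: image_image)
  next
    fix i j x assume "(i, j) \<in> R" "x \<in> topspace X"
    then show "h x i = \<phi> i j (h x j)"
      using him by (auto simp: topspace_inverse_limit)
  next
    fix U x assume U: "openin X U" "x \<in> U"
    have "openin ?L (h ` U)"
      using homeomorphic_map_openness[OF h openin_subset[OF U(1)]] U(1) by blast
    then obtain i V where i: "i \<in> \<Lambda>" "openin (Y i) V" "h x i \<in> V"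
      and V: "{y \<in> topspace ?L. y i \<in> V} \<subseteq> h ` U"
      using inverse_limit_basis[OF sys _ imageI[OF U(2)]] by blast
    have "y \<in> U" if "y \<in> topspace X" "h y i \<in> V" for y
    proof -
      have "h y \<in> h ` U" using V that him by blast
      then show ?thesis
        using that(1) openin_subset[OF U(1)] homeomorphic_imp_injective_map[OF h]
        by (auto dest: inj_onD)
    qed
    then show "\<exists>i\<in>\<Lambda>. \<exists>V. openin (Y i) V \<and> h x i \<in> V \<and> {y \<in> topspace X. h y i \<in> V} \<subseteq> U"
      using i by blast
  qed
qed

end

section \<open>Open partitions of totally disconnected spaces\<close>

text \<open>In a compact Hausdorff space, two closed sets that no connected set joins are separated
  by a clopen set. Here a connected set has at most one point, so it cannot meet both
  \<open>x\<close> and the complement of \<open>U\<close>.\<close>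

lemma totally_disconnected_clopen_neighbourhood:
  assumes "compact_space X" and "Hausdorff_space X" and "totally_disconnected_space X"
    and "openin X U" and "x \<in> U"
  shows "\<exists>C. openin X C \<and> closedin X C \<and> x \<in> C \<and> C \<subseteq> U"
proof -
  have x: "x \<in> topspace X" using openin_subset[OF assms(4)] assms(5) by blast
  have "separated_between X {x} (topspace X - U)"
  proof (rule cut_wire_fence_theorem[OF assms(1,2)])
    show "closedin X {x}"
      using assms(2) x by (simp add: closedin_Hausdorff_singleton)
    show "closedin X (topspace X - U)"
      using assms(4) by (simp add: closedin_diff)
    fix C assume "connectedin X C"
    then obtain a where "C \<subseteq> {a}"
      using assms(3) by (auto simp: totally_disconnected_space_def)
    then show "disjnt C {x} \<or> disjnt C (topspace X - U)"
      using assms(5) by (auto simp: disjnt_def)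
  qed
  then obtain C where C: "closedin X C" "openin X C" "{x} \<subseteq> C" "topspace X - U \<subseteq> topspace X - C"
    unfolding separated_between by blast
  then have "C \<subseteq> U" using openin_subset[OF C(2)] by blast
  then show ?thesis using C by blast
qed

definition open_partition :: "'x topology \<Rightarrow> 'x set set \<Rightarrow> bool" where
  "open_partition X P \<longleftrightarrow> finite_open_cover X P \<and> pairwise disjnt P"

text \<open>Finitely many clopen sets subordinate to the cover suffice to cover \<open>X\<close>;
  the nonempty atoms of the Boolean algebra they generate form the partition.\<close>

lemma open_partition_refining_cover:
  assumes X: "compact_space X" "Hausdorff_space X" "totally_disconnected_space X"
    and cover: "finite_open_cover X \<U>"
  shows "\<exists>P. open_partition X P \<and> (\<forall>c\<in>P. \<exists>U\<in>\<U>. c \<subseteq> U)"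
proof -
  let ?\<C> = "{C. openin X C \<and> closedin X C \<and> (\<exists>U\<in>\<U>. C \<subseteq> U)}"
  have "topspace X \<subseteq> \<Union>?\<C>"
  proof
    fix x assume "x \<in> topspace X"
    then obtain U where U: "U \<in> \<U>" "x \<in> U" "openin X U"
      using cover by (auto simp: finite_open_cover_def)
    then obtain C where "openin X C \<and> closedin X C \<and> x \<in> C \<and> C \<subseteq> U"
      using totally_disconnected_clopen_neighbourhood[OF X U(3,2)] by blast
    then show "x \<in> \<Union>?\<C>" using U(1) by blast
  qed
  then obtain F where F: "finite F" "F \<subseteq> ?\<C>" "topspace X \<subseteq> \<Union>F"
    using X(1)[unfolded compact_space_alt, rule_format, of ?\<C>] by auto
  \<comment> \<open>The atom of the points that belong to exactly those members of \<open>F\<close>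
    that lie in \<open>D\<close>.\<close>
  define E where "E D = {y \<in> topspace X. \<forall>C\<in>F. y \<in> C \<longleftrightarrow> C \<in> D}" for D
  define P where "P = E ` Pow F - {{}}"
  have "openin X (E D)" if "D \<subseteq> F" for D
  proof -
    have "openin X ((\<Inter>C\<in>F. if C \<in> D then C else topspace X - C) \<inter> topspace X)"
      using F(1,2) by (intro openin_INT) (auto simp: openin_diff)
    also have "(\<Inter>C\<in>F. if C \<in> D then C else topspace X - C) \<inter> topspace X = E D"
      by (auto simp: E_def split: if_splits)
    finally show ?thesis .
  qed
  moreover have "x \<in> \<Union>P" if "x \<in> topspace X" for x
  proof -
    let ?D = "{C \<in> F. x \<in> C}"
    have x: "x \<in> E ?D" using that by (auto simp: E_def)
    have "E ?D \<in> E ` Pow F" by (rule imageI) auto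
    then have "E ?D \<in> P" using x by (auto simp: P_def)
    then show ?thesis using x by (rule UnionI)
  qed
  ultimately have "finite_open_cover X P"
    using F(1) unfolding finite_open_cover_def P_def by (auto simp: E_def)
  moreover have "pairwise disjnt P"
  proof (rule pairwiseI)
    fix a b assume ab: "a \<in> P" "b \<in> P" "a \<noteq> b"
    then obtain D D' where D: "D \<subseteq> F" "D' \<subseteq> F" "a = E D" "b = E D'" by (auto simp: P_def)
    have "D = D'" if "x \<in> a" "x \<in> b" for x
      using that D by (auto simp: E_def)
    then show "disjnt a b" using ab(3) D(3,4) by (auto simp: disjnt_def)
  qed
  moreover have "\<exists>U\<in>\<U>. c \<subseteq> U" if "c \<in> P" for c
  proof -
    obtain D x where D: "c = E D" "x \<in> E D" using \<open>c \<in> P\<close> by (auto simp: P_def)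
    \<comment> \<open>An atom with a point in \<open>C\<close> lies entirely in \<open>C\<close>,
      hence in a member of \<open>\<U>\<close>.\<close>
    then obtain C where C: "C \<in> F" "x \<in> C" using F(3) by (auto simp: E_def)
    then have "c \<subseteq> C" using D by (auto simp: E_def)
    moreover obtain U where "U \<in> \<U>" "C \<subseteq> U"
      using subsetD[OF F(2) C(1)] by auto
    ultimately show ?thesis by (meson subset_trans)
  qed
  ultimately show ?thesis by (auto simp: open_partition_def)
qed

lemma open_partition_refining_two_covers:
  assumes X: "compact_space X" "Hausdorff_space X" "totally_disconnected_space X"
    and "finite_open_cover X \<U>" and "finite_open_cover X \<V>"
  shows "\<exists>P. open_partition X P \<and> (\<forall>c\<in>P. (\<exists>U\<in>\<U>. c \<subseteq> U) \<and> (\<exists>V\<in>\<V>. c \<subseteq> V))"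
proof -
  define \<W> where "\<W> = (\<lambda>(U, V). U \<inter> V) ` (\<U> \<times> \<V>) - {{}}"
  have "\<Union>\<W> = \<Union>\<U> \<inter> \<Union>\<V>" by (auto simp: \<W>_def)
  moreover have "finite \<W>" "\<forall>W\<in>\<W>. openin X W \<and> W \<noteq> {}"
    using assms(4,5) by (auto simp: finite_open_cover_def \<W>_def)
  ultimately have \<W>: "finite_open_cover X \<W>"
    using assms(4,5) by (simp add: finite_open_cover_def)
  obtain P where P: "open_partition X P" "\<forall>c\<in>P. \<exists>W\<in>\<W>. c \<subseteq> W"
    using open_partition_refining_cover[OF X \<W>] by blast
  have "(\<exists>U\<in>\<U>. c \<subseteq> U) \<and> (\<exists>V\<in>\<V>. c \<subseteq> V)" if c: "c \<in> P" for c
  proof -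
    obtain W where "W \<in> \<W>" "c \<subseteq> W" using P(2) c by blast
    then obtain U V where "U \<in> \<U>" "V \<in> \<V>" "c \<subseteq> U" "c \<subseteq> V" by (auto simp: \<W>_def)
    then show ?thesis by metis
  qed
  then show ?thesis using P(1) by blast
qed

section \<open>Cells, coarsening and the order by refinement\<close>

definition cell :: "'x set set \<Rightarrow> 'x \<Rightarrow> 'x set" where
  "cell P x = (THE c. c \<in> P \<and> x \<in> c)"

text \<open>The letter-to-letter map behind the bonding maps. For a letter \<open>d\<close> of a
  refinement of the open partition \<open>P\<close> the description is unique, as \<open>d\<close>
  is nonempty and the cells of \<open>P\<close> are disjoint.\<close>

definition coarsen :: "'x set set \<Rightarrow> 'x set \<Rightarrow> 'x set" where
  "coarsen P d = (THE c. c \<in> P \<and> d \<subseteq> c)"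

text \<open>Finer partitions are larger, so the bonding maps run from fine to coarse.\<close>

definition refinement :: "'x topology \<Rightarrow> 'x set set rel" where
  "refinement X = {(P, Q). open_partition X P \<and> open_partition X Q \<and> (\<forall>d\<in>Q. \<exists>c\<in>P. d \<subseteq> c)}"

lemma open_partition_unique:
  assumes "open_partition X P" and "c \<in> P" and "d \<in> P" and "x \<in> c" and "x \<in> d"
  shows "c = d"
  using assms by (auto simp: open_partition_def pairwise_def disjnt_iff)

lemma cell_eq:
  assumes "open_partition X P" and "c \<in> P" and "x \<in> c"
  shows "cell P x = c"
  unfolding cell_def using assms open_partition_unique by (intro the_equality) fast+

lemma cell_mem:
  assumes "open_partition X P" and "x \<in> topspace X"
  shows "cell P x \<in> P" and "x \<in> cell P x"
proof -
  obtain c where "c \<in> P" "x \<in> c"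
    using assms by (auto simp: open_partition_def finite_open_cover_def)
  then show "cell P x \<in> P" and "x \<in> cell P x" using cell_eq[OF assms(1)] by auto
qed

lemma open_partition_cellD:
  assumes "open_partition X P" and "c \<in> P"
  shows "openin X c" and "c \<noteq> {}" and "c \<subseteq> topspace X"
  using assms openin_subset by (auto simp: open_partition_def finite_open_cover_def)

lemma coarsen_eq:
  assumes "open_partition X P" and "c \<in> P" and "d \<subseteq> c" and "x \<in> d"
  shows "coarsen P d = c"
  unfolding coarsen_def
proof (rule the_equality)
  fix c' assume "c' \<in> P \<and> d \<subseteq> c'"
  then show "c' = c" using open_partition_unique[OF assms(1) _ assms(2), of c' x] assms(3,4) by blast
qed (use assms in simp)

lemma coarsen_mem:
  assumes "(P, Q) \<in> refinement X" and "d \<in> Q"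
  shows "coarsen P d \<in> P" and "d \<subseteq> coarsen P d"
proof -
  have PQ: "open_partition X P" "open_partition X Q" using assms(1) by (auto simp: refinement_def)
  obtain c x where "c \<in> P" "d \<subseteq> c" "x \<in> d"
    using assms open_partition_cellD(2)[OF PQ(2) assms(2)] unfolding refinement_def by blast
  then show "coarsen P d \<in> P" and "d \<subseteq> coarsen P d" using coarsen_eq[OF PQ(1)] by auto
qed

lemma coarsen_cell:
  assumes "(P, Q) \<in> refinement X" and "x \<in> topspace X"
  shows "coarsen P (cell Q x) = cell P x"
proof -
  have PQ: "open_partition X P" "open_partition X Q" using assms(1) by (auto simp: refinement_def)
  note c = cell_mem[OF PQ(2) assms(2)]
  show ?thesis
    using cell_eq[OF PQ(1) coarsen_mem(1)[OF assms(1) c(1)]] coarsen_mem(2)[OF assms(1) c(1)] c(2)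
    by auto
qed

lemma coarsen_refl:
  assumes "open_partition X P" and "c \<in> P"
  shows "coarsen P c = c"
  using coarsen_eq[OF assms order_refl] open_partition_cellD(2)[OF assms] by blast

lemma coarsen_coarsen:
  assumes "(P, Q) \<in> refinement X" and "(Q, T) \<in> refinement X" and "e \<in> T"
  shows "coarsen P (coarsen Q e) = coarsen P e"
proof -
  have PT: "open_partition X P" "open_partition X T" using assms by (auto simp: refinement_def)
  note 1 = coarsen_mem[OF assms(2,3)]
  note 2 = coarsen_mem[OF assms(1) 1(1)]
  obtain x where "x \<in> e" using open_partition_cellD(2)[OF PT(2) assms(3)] by blast
  then show ?thesis using coarsen_eq[OF PT(1) 2(1), of e x] 1 2 by blast
qed

lemma continuous_map_cell:
  assumes "open_partition X P"
  shows "continuous_map X (discrete_topology P) (cell P)"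
proof (rule continuous_map_to_discrete)
  fix c assume c: "c \<in> P"
  have "{x \<in> topspace X. cell P x = c} = c"
    using cell_eq[OF assms c] cell_mem[OF assms] open_partition_cellD(3)[OF assms c] by blast
  then show "openin X {x \<in> topspace X. cell P x = c}"
    using open_partition_cellD(1)[OF assms c] by simp
qed (rule cell_mem(1)[OF assms])

lemma directed_set_open_partitions:
  assumes X: "compact_space X" "Hausdorff_space X" "totally_disconnected_space X"
  shows "directed_set {P. open_partition X P} (refinement X)"
  unfolding directed_set_def
proof (intro conjI ballI)
  \<comment> \<open>The trivial cover; removing \<open>{}\<close> keeps it legitimate when
    \<open>X\<close> is empty.\<close>
  have "finite_open_cover X ({topspace X} - {{}})"
    by (auto simp: finite_open_cover_def)
  from open_partition_refining_cover[OF X this] show "{P. open_partition X P} \<noteq> {}"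
    by blast
  have "trans (refinement X)"
    unfolding refinement_def trans_def by (auto, meson subset_trans)
  then show "preorder_on {P. open_partition X P} (refinement X)"
    by (auto simp: preorder_on_def refl_on_def refinement_def)
  fix P Q assume "P \<in> {P. open_partition X P}" "Q \<in> {P. open_partition X P}"
  then show "\<exists>T\<in>{P. open_partition X P}. (P, T) \<in> refinement X \<and> (Q, T) \<in> refinement X"
    using open_partition_refining_two_covers[OF X, of P Q]
    by (auto simp: refinement_def open_partition_def)
qed


section \<open>Itineraries\<close>

locale totally_disconnected_system = group G for G :: "('g, 'm) monoid_scheme" (structure) +
  fixes X :: "'x topology" and \<Phi> :: "'g \<Rightarrow> 'x \<Rightarrow> 'x" and S :: "'g set"
  assumes dynamical: "dynamical_system G X \<Phi>"
    and totally_disconnected: "totally_disconnected_space X"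
    and finite_S: "finite S" and S_subset: "S \<subseteq> carrier G"
begin

text \<open>The condition at \<open>g\<close> involves only the letters at \<open>g\<close> and at
  \<open>s \<otimes> g\<close> for \<open>s \<in> S\<close>, so it is a local rule with window
  \<open>S \<union> {\<one>}\<close>.\<close>

definition itinerary_shift :: "'x set set \<Rightarrow> ('g \<Rightarrow> 'x set) set" where
  "itinerary_shift P =
     {u \<in> carrier G \<rightarrow>\<^sub>E P. \<forall>g\<in>carrier G. \<exists>x\<in>u g. \<forall>s\<in>S. \<Phi> s x \<in> u (s \<otimes> g)}"

definition itinerary :: "'x set set \<Rightarrow> 'x \<Rightarrow> 'g \<Rightarrow> 'x set" where
  "itinerary P x = (\<lambda>g\<in>carrier G. cell P (\<Phi> g x))"

definition bonding :: "'x set set \<Rightarrow> 'x set set \<Rightarrow> ('g \<Rightarrow> 'x set) \<Rightarrow> ('g \<Rightarrow> 'x set)" where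
  "bonding P Q u = (\<lambda>g\<in>carrier G. coarsen P (u g))"

abbreviation "partitions \<equiv> {P. open_partition X P}"

abbreviation "shift_space P \<equiv> subshift_space G P (itinerary_shift P)"

lemma compact_X: "compact_space X" and Hausdorff_X: "Hausdorff_space X"
  using dynamical by (auto simp: dynamical_system_def)

lemma continuous_action: "g \<in> carrier G \<Longrightarrow> continuous_map X X (\<Phi> g)"
  using dynamical homeomorphic_imp_continuous_map by (auto simp: dynamical_system_def)

lemma action_mem: "g \<in> carrier G \<Longrightarrow> x \<in> topspace X \<Longrightarrow> \<Phi> g x \<in> topspace X"
  using continuous_map_image_subset_topspace[OF continuous_action] by blast

lemma action_mult:
  "g \<in> carrier G \<Longrightarrow> h \<in> carrier G \<Longrightarrow> x \<in> topspace X \<Longrightarrow> \<Phi> g (\<Phi> h x) = \<Phi> (g \<otimes> h) x"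
  using dynamical by (simp add: dynamical_system_def)

lemma action_one: "x \<in> topspace X \<Longrightarrow> \<Phi> \<one> x = x"
  using dynamical by (simp add: dynamical_system_def)

lemmas directed_partitions =
  directed_set_open_partitions[OF compact_X Hausdorff_X totally_disconnected]

lemma shift_of_finite_type_itinerary_shift:
  assumes "open_partition X P"
  shows "shift_of_finite_type G P (S \<union> {\<one>}) (itinerary_shift P)"
proof -
  let ?A = "S \<union> {\<one>}"
  \<comment> \<open>The patterns for which no point of the letter at \<open>\<one>\<close> is sent
    into the letter at \<open>s\<close> for all \<open>s \<in> S\<close> at once.\<close>
  define \<F> where "\<F> = {p \<in> ?A \<rightarrow>\<^sub>E P. \<not> (\<exists>x\<in>p \<one>. \<forall>s\<in>S. \<Phi> s x \<in> p s)}"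
  have A: "finite ?A" "?A \<subseteq> carrier G" using finite_S S_subset by auto
  have "(\<exists>x\<in>u g. \<forall>s\<in>S. \<Phi> s x \<in> u (s \<otimes> g)) \<longleftrightarrow>
      (\<forall>p\<in>\<F>. shift G g u \<notin> cylinder G P ?A p)"
    if u: "u \<in> carrier G \<rightarrow>\<^sub>E P" and g: "g \<in> carrier G" for u g
  proof -
    have sh: "shift G g u \<one> = u g" "\<And>s. s \<in> S \<Longrightarrow> shift G g u s = u (s \<otimes> g)"
      using g S_subset by (auto simp: shift_def)
    \<comment> \<open>The pattern that \<open>u\<close> shows around \<open>g\<close>; any pattern
      whose cylinder contains \<open>shift G g u\<close> has the same values on the window.\<close>
    let ?p = "restrict (shift G g u) ?A"
    have p: "?p \<in> ?A \<rightarrow>\<^sub>E P" "shift G g u \<in> cylinder G P ?A ?p"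
      using shift_in_PiE[OF g u] A(2) by (auto simp: cylinder_def)
    have "p \<one> = u g \<and> (\<forall>s\<in>S. p s = u (s \<otimes> g))" if "shift G g u \<in> cylinder G P ?A p" for p
      using that sh by (auto simp: cylinder_def)
    note val = this
    show ?thesis
    proof
      assume L: "\<exists>x\<in>u g. \<forall>s\<in>S. \<Phi> s x \<in> u (s \<otimes> g)"
      show "\<forall>p\<in>\<F>. shift G g u \<notin> cylinder G P ?A p"
      proof (intro ballI notI)
        fix p assume "p \<in> \<F>" "shift G g u \<in> cylinder G P ?A p"
        then show False using L val[of p] by (auto simp: \<F>_def)
      qed
    next
      assume "\<forall>p\<in>\<F>. shift G g u \<notin> cylinder G P ?A p"
      then have "?p \<notin> \<F>" using p(2) by metis
      then show "\<exists>x\<in>u g. \<forall>s\<in>S. \<Phi> s x \<in> u (s \<otimes> g)"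
        using p(1) val[OF p(2)] by (simp add: \<F>_def)
    qed
  qed
  then have eq: "itinerary_shift P =
      {u \<in> carrier G \<rightarrow>\<^sub>E P. \<forall>g\<in>carrier G. \<forall>p\<in>\<F>. shift G g u \<notin> cylinder G P ?A p}"
    unfolding itinerary_shift_def by (intro Collect_cong conj_cong ball_cong refl)
  have "finite P" using assms by (simp add: open_partition_def finite_open_cover_def)
  then have "subshift G P (itinerary_shift P)"
    unfolding eq using A by (rule subshift_forbidden_patterns)
  then show ?thesis
    unfolding shift_of_finite_type_def
    by (intro conjI A exI[of _ \<F>] eq) (auto simp: \<F>_def)
qed

lemma subshift_itinerary_shift:
  "open_partition X P \<Longrightarrow> subshift G P (itinerary_shift P)"
  using shift_of_finite_type_itinerary_shift by (simp add: shift_of_finite_type_def)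

lemma topspace_shift_space:
  "open_partition X P \<Longrightarrow> topspace (shift_space P) = itinerary_shift P"
  by (rule topspace_subshift_space[OF subshift_itinerary_shift])

section \<open>Itineraries of points\<close>

lemma itinerary_mem:
  assumes P: "open_partition X P" and x: "x \<in> topspace X"
  shows "itinerary P x \<in> itinerary_shift P"
  unfolding itinerary_shift_def
proof (intro CollectI conjI ballI)
  show "itinerary P x \<in> carrier G \<rightarrow>\<^sub>E P"
    using cell_mem(1)[OF P] action_mem x by (auto simp: itinerary_def)
  fix g assume g: "g \<in> carrier G"
  show "\<exists>y\<in>itinerary P x g. \<forall>s\<in>S. \<Phi> s y \<in> itinerary P x (s \<otimes> g)"
  proof (intro bexI ballI)
    \<comment> \<open>The orbit point at time \<open>g\<close> is the required witness, because
      \<open>\<Phi> s\<close> moves it to the orbit point at time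
      \<open>s \<otimes> g\<close>.\<close>
    show "\<Phi> g x \<in> itinerary P x g"
      using cell_mem(2)[OF P action_mem[OF g x]] g by (simp add: itinerary_def)
    fix s assume "s \<in> S"
    then have s: "s \<in> carrier G" using S_subset by blast
    then show "\<Phi> s (\<Phi> g x) \<in> itinerary P x (s \<otimes> g)"
      using cell_mem(2)[OF P action_mem[OF _ x], of "s \<otimes> g"] g
      by (simp add: itinerary_def action_mult x)
  qed
qed

lemma itinerary_action:
  assumes "g \<in> carrier G" and "x \<in> topspace X"
  shows "itinerary P (\<Phi> g x) = shift G g (itinerary P x)"
  using assms by (auto simp: itinerary_def shift_def action_mult fun_eq_iff)

lemma continuous_map_itinerary:
  assumes P: "open_partition X P"
  shows "continuous_map X (shift_space P) (itinerary P)"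
proof (intro continuous_map_into_subtopology continuous_map_to_full_shift)
  fix g assume g: "g \<in> carrier G"
  show "continuous_map X (discrete_topology P) (\<lambda>x. itinerary P x g)"
    using continuous_map_compose[OF continuous_action[OF g] continuous_map_cell[OF P]] g
    by (simp add: itinerary_def comp_def)
qed (use itinerary_mem[OF P] in \<open>auto simp: itinerary_def\<close>)

section \<open>Bonding maps and the inverse system\<close>

lemma bonding_itinerary:
  assumes "(P, Q) \<in> refinement X" and "x \<in> topspace X"
  shows "bonding P Q (itinerary Q x) = itinerary P x"
  using coarsen_cell[OF assms(1)] action_mem assms(2)
  by (auto simp: bonding_def itinerary_def fun_eq_iff)

text \<open>Coarsening only enlarges letters, so a witness for \<open>u\<close> at \<open>g\<close>
  remains a witness.\<close>

lemma bonding_mem: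
  assumes PQ: "(P, Q) \<in> refinement X" and u: "u \<in> itinerary_shift Q"
  shows "bonding P Q u \<in> itinerary_shift P"
  unfolding itinerary_shift_def
proof (intro CollectI conjI ballI)
  have uQ: "u g \<in> Q" if "g \<in> carrier G" for g
    using u that by (auto simp: itinerary_shift_def)
  then show "bonding P Q u \<in> carrier G \<rightarrow>\<^sub>E P"
    using coarsen_mem(1)[OF PQ] by (auto simp: bonding_def)
  fix g assume g: "g \<in> carrier G"
  obtain x where "x \<in> u g" "\<forall>s\<in>S. \<Phi> s x \<in> u (s \<otimes> g)"
    using u g by (auto simp: itinerary_shift_def)
  moreover have "u (s \<otimes> g) \<subseteq> bonding P Q u (s \<otimes> g)" if "s \<in> S" for s
    using coarsen_mem(2)[OF PQ uQ] that g S_subset by (auto simp: bonding_def)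
  moreover have "u g \<subseteq> bonding P Q u g"
    using coarsen_mem(2)[OF PQ uQ] g by (auto simp: bonding_def)
  ultimately show "\<exists>x\<in>bonding P Q u g. \<forall>s\<in>S. \<Phi> s x \<in> bonding P Q u (s \<otimes> g)" by blast
qed

lemma continuous_map_bonding:
  assumes PQ: "(P, Q) \<in> refinement X"
  shows "continuous_map (shift_space Q) (shift_space P) (bonding P Q)"
proof (intro continuous_map_into_subtopology continuous_map_to_full_shift)
  have Q: "open_partition X Q" using PQ by (simp add: refinement_def)
  show "bonding P Q \<in> topspace (shift_space Q) \<rightarrow> itinerary_shift P"
    unfolding topspace_shift_space[OF Q] using bonding_mem[OF PQ] by blast
  fix g assume g: "g \<in> carrier G"
  have "continuous_map (discrete_topology Q) (discrete_topology P) (coarsen P)"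
    using coarsen_mem(1)[OF PQ] by simp
  from continuous_map_compose[OF continuous_map_from_subtopology this]
  show "continuous_map (shift_space Q) (discrete_topology P) (\<lambda>u. bonding P Q u g)"
    using continuous_map_full_shift_coordinate[OF g] g by (force simp: bonding_def comp_def)
qed (simp add: bonding_def)

lemma inverse_system_itinerary_shifts:
  "inverse_system G partitions (refinement X) shift_space (\<lambda>_. shift G) bonding"
  unfolding inverse_system_def
proof (intro conjI ballI allI impI)
  show "directed_set partitions (refinement X)" by (rule directed_partitions)
next
  fix P assume "P \<in> partitions"
  then show "dynamical_system G (shift_space P) (shift G)"
    by (intro dynamical_system_subshift subshift_itinerary_shift) simp
next
  fix P u assume P: "P \<in> partitions" and "u \<in> topspace (shift_space P)"
  then have "u \<in> carrier G \<rightarrow>\<^sub>E P" by (auto simp: itinerary_shift_def)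
  then show "bonding P P u = u"
    using coarsen_refl[of X P] P by (auto simp: bonding_def fun_eq_iff PiE_iff extensional_def)
next
  fix P Q assume "(P, Q) \<in> refinement X"
  then show "continuous_map (shift_space Q) (shift_space P) (bonding P Q)"
    by (rule continuous_map_bonding)
next
  fix P Q T u assume PQT: "(P, Q) \<in> refinement X" "(Q, T) \<in> refinement X"
    and "u \<in> topspace (shift_space T)"
  then have "u \<in> carrier G \<rightarrow>\<^sub>E T" by (auto simp: itinerary_shift_def)
  then show "bonding P T u = bonding P Q (bonding Q T u)"
    using coarsen_coarsen[OF PQT] by (auto simp: bonding_def fun_eq_iff)
next
  fix P Q g u assume "g \<in> carrier G"
  then show "shift G g (bonding P Q u) = bonding P Q (shift G g u)"
    by (auto simp: bonding_def shift_def fun_eq_iff)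
qed

text \<open>This is where shadowing enters. \<open>Q\<close> refines \<open>P\<close>, so that
  letters can be coarsened, and also the cover \<open>\<V>\<close> supplied by shadowing for
  accuracy \<open>P\<close>, so that witnesses for a sequence over \<open>Q\<close> form a
  pseudo-orbit. Since the cells of \<open>P\<close> are disjoint, shadowing up to \<open>P\<close>
  means having exactly the prescribed itinerary.\<close>

lemma bonding_image_subset_itineraries:
  assumes shadowing: "shadowing_property G X \<Phi> S" and P: "open_partition X P"
  shows "\<exists>Q. (P, Q) \<in> refinement X \<and> bonding P Q ` itinerary_shift Q \<subseteq> itinerary P ` topspace X"
proof -
  have coverP: "finite_open_cover X P" using P by (simp add: open_partition_def)
  then obtain \<V> where \<V>: "finite_open_cover X \<V>"
    and shadow: "\<forall>x. pseudo_orbit G X \<Phi> S \<V> x \<longrightarrow> (\<exists>z\<in>topspace X. shadows G \<Phi> P z x)"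
    using shadowing[unfolded shadowing_property_def] by blast
  obtain Q where Q: "open_partition X Q"
    and fine: "\<forall>d\<in>Q. (\<exists>c\<in>P. d \<subseteq> c) \<and> (\<exists>V\<in>\<V>. d \<subseteq> V)"
    using open_partition_refining_two_covers[OF compact_X Hausdorff_X totally_disconnected coverP \<V>]
    by blast
  have PQ: "(P, Q) \<in> refinement X" using P Q fine by (simp add: refinement_def)
  have "bonding P Q u \<in> itinerary P ` topspace X" if u: "u \<in> itinerary_shift Q" for u
  proof -
    have uQ: "u g \<in> Q" if "g \<in> carrier G" for g
      using u that by (auto simp: itinerary_shift_def)
    have "\<forall>g\<in>carrier G. \<exists>x. x \<in> u g \<and> (\<forall>s\<in>S. \<Phi> s x \<in> u (s \<otimes> g))"
      using u by (auto simp: itinerary_shift_def)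
    then obtain x where x: "\<forall>g\<in>carrier G. x g \<in> u g \<and> (\<forall>s\<in>S. \<Phi> s (x g) \<in> u (s \<otimes> g))"
      by metis
    have "\<forall>d\<in>Q. \<exists>V\<in>\<V>. d \<subseteq> V" using fine by simp
    \<comment> \<open>Members of \<open>\<V>\<close> may overlap, so one containing each letter of
      \<open>Q\<close> is fixed; \<open>f (u g)\<close> is then the set attached to \<open>g\<close>
      in the pseudo-orbit.\<close>
    then obtain f where f: "\<forall>d\<in>Q. f d \<in> \<V> \<and> d \<subseteq> f d" by metis
    have xX: "x g \<in> topspace X" if "g \<in> carrier G" for g
      using x that open_partition_cellD(3)[OF Q uQ[OF that]] by blast
    have "pseudo_orbit G X \<Phi> S \<V> x"
      unfolding pseudo_orbit_def
    proof (intro conjI ballI exI[of _ "\<lambda>g. f (u g)"])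
      fix g assume g: "g \<in> carrier G"
      show "x g \<in> topspace X" by (rule xX[OF g])
      show "f (u g) \<in> \<V>" using f uQ[OF g] by blast
      fix s assume s: "s \<in> S"
      have sg: "s \<otimes> g \<in> carrier G" using s g S_subset by auto
      have "u (s \<otimes> g) \<subseteq> f (u (s \<otimes> g))" using f uQ[OF sg] by blast
      then show "x (s \<otimes> g) \<in> f (u (s \<otimes> g))" and "\<Phi> s (x g) \<in> f (u (s \<otimes> g))"
        using x g s sg by auto
    qed
    then obtain z where z: "z \<in> topspace X" "shadows G \<Phi> P z x" using shadow by blast
    have "bonding P Q u g = itinerary P z g" for g
    proof (cases "g \<in> carrier G")
      case g: True
      obtain c where c: "c \<in> P" "\<Phi> g z \<in> c" "x g \<in> c"
        using z(2) g by (auto simp: shadows_def)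
      \<comment> \<open>The cell \<open>c\<close> given by shadowing and the coarsened letter share
        the point \<open>x g\<close>, so they coincide.\<close>
      have "x g \<in> coarsen P (u g)" using coarsen_mem(2)[OF PQ uQ[OF g]] x g by blast
      then have "coarsen P (u g) = c"
        using open_partition_unique[OF P coarsen_mem(1)[OF PQ uQ[OF g]] c(1)] c(3) by blast
      then show ?thesis
        using g cell_eq[OF P c(1,2)] by (simp add: bonding_def itinerary_def)
    qed (simp add: bonding_def itinerary_def)
    then show ?thesis using z(1) by (auto simp: fun_eq_iff image_iff)
  qed
  then show ?thesis using PQ by blast
qed

text \<open>For every \<open>T\<close> finer than \<open>Q\<close> the image in the shift of
  \<open>P\<close> is exactly the set of itineraries of points of \<open>X\<close>: itineraries lift
  to \<open>T\<close>, while everything from \<open>T\<close> factors through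
  \<open>Q\<close>.\<close>

lemma mittag_leffler_itinerary_shifts:
  assumes "shadowing_property G X \<Phi> S"
  shows "mittag_leffler partitions (refinement X) shift_space bonding"
  unfolding mittag_leffler_def
proof
  fix P assume "P \<in> partitions"
  then obtain Q where PQ: "(P, Q) \<in> refinement X"
    and sub: "bonding P Q ` itinerary_shift Q \<subseteq> itinerary P ` topspace X"
    using bonding_image_subset_itineraries[OF assms, of P] by auto
  have Q: "open_partition X Q" using PQ by (simp add: refinement_def)
  have "bonding P T ` itinerary_shift T = itinerary P ` topspace X"
    if QT: "(Q, T) \<in> refinement X" for T
  proof
    have T: "open_partition X T" and PT: "(P, T) \<in> refinement X"
      using QT directed_set_trans[OF directed_partitions PQ QT] by (auto simp: refinement_def)
    show "itinerary P ` topspace X \<subseteq> bonding P T ` itinerary_shift T"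
      using itinerary_mem[OF T] bonding_itinerary[OF PT] by (force simp: image_iff)
    have "bonding P T u = bonding P Q (bonding Q T u)" if "u \<in> itinerary_shift T" for u
      using inverse_systemD(7)[OF inverse_system_itinerary_shifts PQ QT, of u] that
      by (simp only: topspace_shift_space[OF T])
    then show "bonding P T ` itinerary_shift T \<subseteq> itinerary P ` topspace X"
      using sub bonding_mem[OF QT] by auto
  qed
  \<comment> \<open>Reflexivity makes \<open>Q\<close> itself one of the admissible
    \<open>T\<close>, so both sides equal the set of itineraries.\<close>
  then have "bonding P T ` topspace (shift_space T) = bonding P Q ` topspace (shift_space Q)"
    if "(Q, T) \<in> refinement X" for T
    using that directed_set_refl[OF directed_partitions, of Q] Q topspace_shift_space[of T]
      topspace_shift_space[OF Q] by (auto simp: refinement_def)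
  then show "\<exists>Q. (P, Q) \<in> refinement X \<and> (\<forall>T. (Q, T) \<in> refinement X \<longrightarrow>
      bonding P T ` topspace (shift_space T) = bonding P Q ` topspace (shift_space Q))"
    using PQ by blast
qed

text \<open>A cell inside the complement of \<open>x\<close> or of \<open>y\<close> cannot contain
  both points, so a partition refining this two-set cover already separates them at time
  \<open>\<one>\<close>.\<close>

lemma itinerary_separates_points:
  assumes x: "x \<in> topspace X" and y: "y \<in> topspace X"
    and eq: "\<And>P. open_partition X P \<Longrightarrow> itinerary P x = itinerary P y"
  shows "x = y"
proof (rule ccontr)
  assume "x \<noteq> y"
  have "openin X (topspace X - {a})" if "a \<in> topspace X" for a
    using that Hausdorff_X by (simp add: closedin_Hausdorff_singleton openin_diff)
  then have "finite_open_cover X {topspace X - {x}, topspace X - {y}}"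
    using x y \<open>x \<noteq> y\<close> by (auto simp: finite_open_cover_def)
  from open_partition_refining_cover[OF compact_X Hausdorff_X totally_disconnected this]
  obtain P where P: "open_partition X P"
    and fine: "\<forall>c\<in>P. \<exists>U\<in>{topspace X - {x}, topspace X - {y}}. c \<subseteq> U"
    by blast
  have "cell P x = cell P y"
    using fun_cong[OF eq[OF P], of \<one>] by (simp add: itinerary_def action_one x y)
  then show False using fine cell_mem[OF P x] cell_mem[OF P y] by blast
qed

text \<open>The map sending a point to all its itineraries is a continuous bijection from a compact
  space onto a Hausdorff space. Shadowing is needed for surjectivity.\<close>

lemma conjugate_itinerary_limit:
  assumes shadowing: "shadowing_property G X \<Phi> S"
  shows "conjugate G X \<Phi> (inverse_limit partitions (refinement X) shift_space bonding)
    (inverse_limit_action partitions (\<lambda>_. shift G))"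
proof -
  let ?L = "inverse_limit partitions (refinement X) shift_space bonding"
  define h where "h x = (\<lambda>P\<in>partitions. itinerary P x)" for x
  have refD: "open_partition X P" "open_partition X Q" if "(P, Q) \<in> refinement X" for P Q
    using that by (auto simp: refinement_def)
  have "continuous_map X (product_topology shift_space partitions) h"
    unfolding continuous_map_componentwise
    using continuous_map_itinerary by (auto simp: h_def)
  then have cont: "continuous_map X ?L h"
    unfolding inverse_limit_def
    by (rule continuous_map_into_subtopology) (auto simp: h_def bonding_itinerary dest: refD)
  moreover have "inj_on h (topspace X)"
  proof (rule inj_onI)
    fix x y assume xy: "x \<in> topspace X" "y \<in> topspace X" "h x = h y"
    have "itinerary P x = itinerary P y" if "open_partition X P" for P
      using fun_cong[OF xy(3), of P] that by (simp add: h_def)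
    then show "x = y" by (rule itinerary_separates_points[OF xy(1,2)])
  qed
  moreover have "h ` topspace X = topspace ?L"
  proof
    show "h ` topspace X \<subseteq> topspace ?L" by (rule continuous_map_image_subset_topspace[OF cont])
    show "topspace ?L \<subseteq> h ` topspace X"
    proof
      fix u assume "u \<in> topspace ?L"
      then have ext: "u \<in> (\<Pi>\<^sub>E P\<in>partitions. topspace (shift_space P))"
        and comp: "\<And>P Q. (P, Q) \<in> refinement X \<Longrightarrow> u P = bonding P Q (u Q)"
        by (auto simp: topspace_inverse_limit)
      have uY: "u P \<in> topspace (shift_space P)" if "open_partition X P" for P
        using PiE_mem[OF ext, of P] that by simp
      \<comment> \<open>The points with the itinerary prescribed at level \<open>P\<close>; a point
        in all these sets is a preimage of \<open>u\<close>.\<close>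
      define K where "K P = {x \<in> topspace X. itinerary P x = u P}" for P
      have "(\<Inter>P\<in>partitions. K P) \<noteq> {}"
      proof (rule compact_space_directed_Inter[OF compact_X directed_partitions])
        fix P assume "P \<in> partitions"
        then have P: "open_partition X P" by simp
        show "closedin X (K P)"
          unfolding K_def
          by (rule closedin_continuous_maps_eq[OF Hausdorff_space_subshift_space
                continuous_map_itinerary[OF P]]) (use uY[OF P] in simp)
        obtain Q where PQ: "(P, Q) \<in> refinement X"
          and sub: "bonding P Q ` itinerary_shift Q \<subseteq> itinerary P ` topspace X"
          using bonding_image_subset_itineraries[OF shadowing P] by blast
        \<comment> \<open>Being a thread, \<open>u\<close> has at \<open>P\<close> a value coming
          from level \<open>Q\<close>, and every such value is the itinerary of a point.\<close>
        have "u P \<in> itinerary P ` topspace X"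
          using sub comp[OF PQ] uY[OF refD(2)[OF PQ]] topspace_shift_space[OF refD(2)[OF PQ]]
          by blast
        then show "K P \<noteq> {}" unfolding K_def by (metis (mono_tags) empty_Collect_eq imageE)
      next
        fix P Q assume PQ: "(P, Q) \<in> refinement X"
        show "K Q \<subseteq> K P"
          by (auto simp: K_def comp[OF PQ] simp flip: bonding_itinerary[OF PQ])
      qed
      then obtain x where x: "\<And>P. open_partition X P \<Longrightarrow> x \<in> K P" by blast
      \<comment> \<open>Membership in the intersection places \<open>x\<close> in \<open>X\<close>
        only because at least one partition exists.\<close>
      obtain P where "open_partition X P" using directed_partitions by (auto simp: directed_set_def)
      then have "x \<in> topspace X" using x by (auto simp: K_def)
      moreover have "h x = u"
        using x ext by (auto simp: h_def K_def fun_eq_iff PiE_iff extensional_def)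
      ultimately show "u \<in> h ` topspace X" by blast
    qed
  qed
  moreover have "Hausdorff_space ?L"
    by (rule Hausdorff_space_inverse_limit) (rule Hausdorff_space_subshift_space)
  ultimately have "homeomorphic_map X ?L h"
    using compact_X by (intro continuous_imp_homeomorphic_map)
  moreover have "h (\<Phi> g x) = inverse_limit_action partitions (\<lambda>_. shift G) g (h x)"
    if "g \<in> carrier G" "x \<in> topspace X" for g x
    using that by (auto simp: h_def inverse_limit_action_def itinerary_action)
  ultimately show ?thesis unfolding conjugate_def by blast
qed

end

text \<open>The types in the first implication are dictated by the construction: letters are subsets
  of \<open>X\<close> and indices are sets of such letters. In the second, the index type
  \<open>'l\<close> and the letter type \<open>'a\<close> are arbitrary.\<close>

theorem theorem1p1:
  fixes G :: "('g, 'm) monoid_scheme"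
    and X :: "'x topology"
    and \<Phi> :: "'g \<Rightarrow> 'x \<Rightarrow> 'x"
    and S :: "'g set"
  assumes "group G" and "countable (carrier G)"
    and "dynamical_system G X \<Phi>"
    and "totally_disconnected_space X"
    and "finite S" and "S \<subseteq> carrier G"
  shows
    "(shadowing_property G X \<Phi> S \<longrightarrow>
       (\<exists>(\<Lambda> :: 'x set set set) (R :: 'x set set rel) (\<Sigma> :: 'x set set \<Rightarrow> 'x set set)
          (Y :: 'x set set \<Rightarrow> ('g \<Rightarrow> 'x set) set) \<phi>.
          subshift_ml_system G \<Lambda> R \<Sigma> Y \<phi> \<and>
          (\<forall>i\<in>\<Lambda>. shift_of_finite_type G (\<Sigma> i) (S \<union> {\<one>\<^bsub>G\<^esub>}) (Y i)) \<and>
          conjugate_to_subshift_limit G X \<Phi> \<Lambda> R \<Sigma> Y \<phi>)) \<and>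
     ((\<exists>(\<Lambda> :: 'l set) (R :: 'l rel) (\<Sigma> :: 'l \<Rightarrow> 'a set) (Y :: 'l \<Rightarrow> ('g \<Rightarrow> 'a) set) \<phi>.
          subshift_ml_system G \<Lambda> R \<Sigma> Y \<phi> \<and>
          (\<forall>i\<in>\<Lambda>. shadowing_property G (subshift_space G (\<Sigma> i) (Y i)) (shift G) S) \<and>
          conjugate_to_subshift_limit G X \<Phi> \<Lambda> R \<Sigma> Y \<phi>) \<longrightarrow>
       shadowing_property G X \<Phi> S)"
proof (intro conjI impI)
  interpret group G by (rule assms(1))
  interpret totally_disconnected_system G X \<Phi> S
    using assms(3-6) by unfold_locales
  assume shadowing: "shadowing_property G X \<Phi> S"
  \<comment> \<open>Each partition is its own alphabet, hence the identity as the alphabet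
    map.\<close>
  have "subshift_ml_system G partitions (refinement X) (\<lambda>P. P) itinerary_shift bonding"
    unfolding subshift_ml_system_def
    using subshift_itinerary_shift inverse_system_itinerary_shifts
      mittag_leffler_itinerary_shifts[OF shadowing] by simp
  moreover have "\<forall>P\<in>partitions. shift_of_finite_type G P (S \<union> {\<one>\<^bsub>G\<^esub>}) (itinerary_shift P)"
    using shift_of_finite_type_itinerary_shift by simp
  moreover have "conjugate_to_subshift_limit G X \<Phi> partitions (refinement X) (\<lambda>P. P) itinerary_shift bonding"
    unfolding conjugate_to_subshift_limit_def by (rule conjugate_itinerary_limit[OF shadowing])
  ultimately show "\<exists>(\<Lambda> :: 'x set set set) (R :: 'x set set rel) (\<Sigma> :: 'x set set \<Rightarrow> 'x set set)
      (Y :: 'x set set \<Rightarrow> ('g \<Rightarrow> 'x set) set) \<phi>.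
      subshift_ml_system G \<Lambda> R \<Sigma> Y \<phi> \<and>
      (\<forall>i\<in>\<Lambda>. shift_of_finite_type G (\<Sigma> i) (S \<union> {\<one>\<^bsub>G\<^esub>}) (Y i)) \<and>
      conjugate_to_subshift_limit G X \<Phi> \<Lambda> R \<Sigma> Y \<phi>"
    by (intro exI conjI)
next
  interpret group G by (rule assms(1))
  assume "\<exists>(\<Lambda> :: 'l set) (R :: 'l rel) (\<Sigma> :: 'l \<Rightarrow> 'a set) (Y :: 'l \<Rightarrow> ('g \<Rightarrow> 'a) set) \<phi>.
      subshift_ml_system G \<Lambda> R \<Sigma> Y \<phi> \<and>
      (\<forall>i\<in>\<Lambda>. shadowing_property G (subshift_space G (\<Sigma> i) (Y i)) (shift G) S) \<and>
      conjugate_to_subshift_limit G X \<Phi> \<Lambda> R \<Sigma> Y \<phi>"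
  then show "shadowing_property G X \<Phi> S"
  proof (elim exE conjE)
    fix \<Lambda> :: "'l set" and R and \<Sigma> :: "'l \<Rightarrow> 'a set" and Y \<phi>
    assume sys: "subshift_ml_system G \<Lambda> R \<Sigma> Y \<phi>"
      and shadowing: "\<forall>i\<in>\<Lambda>. shadowing_property G (subshift_space G (\<Sigma> i) (Y i)) (shift G) S"
      and conj: "conjugate_to_subshift_limit G X \<Phi> \<Lambda> R \<Sigma> Y \<phi>"
    show ?thesis
    proof (rule shadowing_property_conjugate_inverse_limit[OF assms(3,6)])
      show "inverse_system G \<Lambda> R (\<lambda>i. subshift_space G (\<Sigma> i) (Y i)) (\<lambda>_. shift G) \<phi>"
        and "mittag_leffler \<Lambda> R (\<lambda>i. subshift_space G (\<Sigma> i) (Y i)) \<phi>"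
        using sys by (simp_all add: subshift_ml_system_def)
      show "conjugate G X \<Phi> (inverse_limit \<Lambda> R (\<lambda>i. subshift_space G (\<Sigma> i) (Y i)) \<phi>)
          (inverse_limit_action \<Lambda> (\<lambda>_. shift G))"
        using conj by (simp add: conjugate_to_subshift_limit_def)
    qed (use shadowing in blast)
  qed
qed


end
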